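(* Let $A\subset\mathbb{Z}^2$ be a minimal set. The following are equivalent: (1) $A$ is dead; (2) $A$ is a box that is not efficient; (3) $A$ is a box that is not congruent to $B(m,m)$ or $B(m,m+1)$ for any $m\in\mathbb{N}$, nor to $B(m-1,m+1)$ for any odd $m\in\mathbb{N}$.
   Context: $X$ is the graph with vertex set $\mathbb{Z}^2$ in which $(x,y)$ and $(x',y')$ are adjacent iff $|x-x'|+|y-y'|=1$. For $A\subset\mathbb{Z}^2$, $\partial A=\{u\in\mathbb{Z}^2\setminus A:\ u \text{ adjacent to some } v\in A\}$. A finite nonempty set $A$ is minimal if $|\partial A|\le|\partial C|$ for all $C$ with $|C|=|A|$. A finite set $A$ is efficient if $|\partial C|=|\partial A|$ implies $|A|\ge|C|$ for every finite $C$. Two sets are congruent if some graph automorphism of $X$ maps one onto the other. For integers $a,b,c,d$, $B(a,b,c,d)=\{(x,y): a\le y-x\le b,\ c\le y+x\le d\}$; a box is a nonempty set of this form; $B(\alpha,\beta)=B(0,\alpha,0,\beta)$. The life expectancy of a minimal set $A$ is the supremum (in $\mathbb{N}\cup\{\infty\}$) of all $n$ such that there is a nested sequence $A=A_0\subset A_1\subset\dots\subset A_n$ of minimal sets with $|A_i|=|A|+i$; $A$ is dead if its life expectancy is $0$. *)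

theory Defs
  imports Main "HOL-Library.Extended_Nat"
begin

type_synonym vertex = "int \<times> int"

definition adj :: "vertex \<Rightarrow> vertex \<Rightarrow> bool" where
  "adj u v \<longleftrightarrow> \<bar>fst u - fst v\<bar> + \<bar>snd u - snd v\<bar> = 1"

definition bdry :: "vertex set \<Rightarrow> vertex set" where
  "bdry A = {u. u \<notin> A \<and> (\<exists>v\<in>A. adj u v)}"

definition minimal :: "vertex set \<Rightarrow> bool" where
  "minimal A \<longleftrightarrow> finite A \<and> A \<noteq> {} \<and>
     (\<forall>C. finite C \<and> card C = card A \<longrightarrow> card (bdry A) \<le> card (bdry C))"

definition efficient :: "vertex set \<Rightarrow> bool" where
  "efficient A \<longleftrightarrow> finite A \<and>
     (\<forall>C. finite C \<and> card (bdry C) = card (bdry A) \<longrightarrow> card A \<ge> card C)"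

definition automorphism :: "(vertex \<Rightarrow> vertex) \<Rightarrow> bool" where
  "automorphism f \<longleftrightarrow> bij f \<and> (\<forall>u v. adj (f u) (f v) \<longleftrightarrow> adj u v)"

definition congruent_sets :: "vertex set \<Rightarrow> vertex set \<Rightarrow> bool" where
  "congruent_sets A C \<longleftrightarrow> (\<exists>f. automorphism f \<and> f ` A = C)"

definition Box4 :: "int \<Rightarrow> int \<Rightarrow> int \<Rightarrow> int \<Rightarrow> vertex set" where
  "Box4 a b c d = {(x, y). a \<le> y - x \<and> y - x \<le> b \<and> c \<le> y + x \<and> y + x \<le> d}"

definition is_box :: "vertex set \<Rightarrow> bool" where
  "is_box A \<longleftrightarrow> A \<noteq> {} \<and> (\<exists>a b c d. A = Box4 a b c d)"

definition Box2 :: "int \<Rightarrow> int \<Rightarrow> vertex set" where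
  "Box2 \<alpha> \<beta> = Box4 0 \<alpha> 0 \<beta>"

definition life_expectancy :: "vertex set \<Rightarrow> enat" where
  "life_expectancy A = Sup {enat n | n. \<exists>S :: nat \<Rightarrow> vertex set. S 0 = A \<and>
     (\<forall>i\<le>n. minimal (S i) \<and> card (S i) = card A + i) \<and>
     (\<forall>i<n. S i \<subseteq> S (Suc i))}"

definition dead :: "vertex set \<Rightarrow> bool" where
  "dead A \<longleftrightarrow> minimal A \<and> life_expectancy A = 0"

end

theory Submission
  imports Defs
begin

text \<open>
  In the rotated coordinates \<open>u = y - x\<close>, \<open>v = y + x\<close> the neighbours of a point are its four diagonal
  neighbours, and a box is a rectangle. Cut a set into its lines \<open>u = const\<close>. A nonempty line of size
  \<open>n\<close> reaches at least \<open>n + 1\<close> points of each adjacent line, so the line sizes alone bound the boundary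
  from below, and centring all lines attains this bound. Summing it gives the isoperimetric inequality
  \<open>8 |C| \<le> (|\<partial>C| - 2)\<^sup>2 + 4\<close>, which identifies the efficient boxes. For a minimal set the bound is
  an equality on every line, which forces longest lines to be intervals containing their neighbours up
  to one step; if moreover no point can be added without enlarging the boundary, then, walking away from
  a longest line, all lines fill the same rectangle. Hence a dead set is a box. Conversely, adding any
  point to a box enlarges its boundary, which is affordable exactly when the box is efficient.
\<close>

text \<open>Only pairs with \<open>u + v\<close> even are vertices, and this parity is the obstacle
  throughout. Consecutive lines of a rectangle can differ in size by one, interior lines can be
  empty (two diagonally adjacent points form a minimal set), and a rectangle with p values of u and
  q values of v has (p q + e) / 2 points, where e is -1, 0 or 1. If its four sides are attained, its
  boundary has p + q + 2 points. With k boundary points, p q \<le> (k - 2)^2 / 4 then gives 8 |C| =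
  4 p q + 4 e \<le> (k - 2)^2 + 4. So the constant 4 is the best parity excess, attained by B(m, m)
  for even m. Since 8 |C| is a multiple of 8, a box that misses the bound by at most 7 is still
  efficient. The third family of the theorem is a parity effect: for odd m the square B(m, m) has
  excess 0, the less balanced B(m - 1, m + 1) has excess 1, and the two have the same size and the
  same boundary.\<close>

section \<open>Rotated coordinates\<close>

definition diag_line :: "vertex set \<Rightarrow> int \<Rightarrow> int set" where
  "diag_line A u = {v. \<exists>x y. (x, y) \<in> A \<and> y - x = u \<and> y + x = v}"

text \<open>Elements of \<open>S u\<close> of the wrong parity denote no vertex and drop out, so
  \<open>S\<close> can be given without regard to parity.\<close>

definition of_lines :: "(int \<Rightarrow> int set) \<Rightarrow> vertex set" where
  "of_lines S = {(x, y). y + x \<in> S (y - x)}"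

definition widen :: "int set \<Rightarrow> int set" where
  "widen X = {v. v - 1 \<in> X \<or> v + 1 \<in> X}"

lemma mem_iff_diag_line: "(x, y) \<in> A \<longleftrightarrow> y + x \<in> diag_line A (y - x)"
proof
  assume "y + x \<in> diag_line A (y - x)"
  then obtain x' y' where *: "(x', y') \<in> A" "y' - x' = y - x" "y' + x' = y + x"
    by (auto simp: diag_line_def)
  then have "x' = x" "y' = y" by linarith+
  with * show "(x, y) \<in> A" by simp
qed (auto simp: diag_line_def)

lemma diag_line_parity: "v \<in> diag_line A u \<Longrightarrow> even (u + v)"
  by (auto simp: diag_line_def)

lemma diag_coordinates:
  assumes "even (u + v)"
  obtains x y :: int where "u = y - x" "v = y + x"
proof -
  from assms obtain y where y: "u + v = 2 * y" by blast
  show thesis by (rule that[of y "v - y"]) (use y in auto)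
qed

lemma diag_line_of_lines: "diag_line (of_lines S) u = {v \<in> S u. even (u + v)}"
proof -
  have "v \<in> diag_line (of_lines S) u" if "v \<in> S u" "even (u + v)" for v
  proof -
    from that(2) obtain x y where "u = y - x" "v = y + x" by (rule diag_coordinates)
    with that(1) show ?thesis by (auto simp: diag_line_def of_lines_def)
  qed
  then show ?thesis by (auto simp: diag_line_def of_lines_def)
qed

lemma adj_iff:
  "adj (x, y) p \<longleftrightarrow> p = (x + 1, y) \<or> p = (x - 1, y) \<or> p = (x, y + 1) \<or> p = (x, y - 1)"
proof (cases p)
  case (Pair x' y')
  have "\<bar>x - x'\<bar> + \<bar>y - y'\<bar> = 1 \<longleftrightarrow>
      (x' = x + 1 \<and> y' = y) \<or> (x' = x - 1 \<and> y' = y) \<or> (x' = x \<and> y' = y + 1) \<or> (x' = x \<and> y' = y - 1)"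
    by presburger
  then show ?thesis by (simp add: adj_def Pair)
qed

lemma mem_bdry_iff:
  "(x, y) \<in> bdry A \<longleftrightarrow> (x, y) \<notin> A \<and>
     ((x + 1, y) \<in> A \<or> (x - 1, y) \<in> A \<or> (x, y + 1) \<in> A \<or> (x, y - 1) \<in> A)"
  by (auto simp: bdry_def adj_iff)

lemma adj_sym: "adj u v \<longleftrightarrow> adj v u"
  by (simp add: adj_def abs_minus_commute)

lemma finite_nbrs: "finite {p. adj q p}"
proof (cases q)
  case (Pair x y)
  have "{p. adj q p} = {(x + 1, y), (x - 1, y), (x, y + 1), (x, y - 1)}"
    by (auto simp: Pair adj_iff)
  then show ?thesis by simp
qed

lemma finite_bdry: "finite A \<Longrightarrow> finite (bdry A)"
proof -
  assume "finite A"
  have "bdry A \<subseteq> (\<Union>q\<in>A. {p. adj q p})" by (auto simp: bdry_def adj_sym)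
  then show ?thesis by (rule finite_subset) (use \<open>finite A\<close> finite_nbrs in auto)
qed

lemma mem_diag_line_bdry_aux:
  "y + x \<in> diag_line (bdry A) (y - x) \<longleftrightarrow>
   y + x \<in> (widen (diag_line A (y - x - 1)) \<union> widen (diag_line A (y - x + 1))) - diag_line A (y - x)"
proof -
  have 1: "y + x + 1 \<in> diag_line A (y - x - 1) \<longleftrightarrow> (x + 1, y) \<in> A"
    using mem_iff_diag_line[of "x + 1" y A] by (simp add: algebra_simps)
  have 2: "y + x - 1 \<in> diag_line A (y - x + 1) \<longleftrightarrow> (x - 1, y) \<in> A"
    using mem_iff_diag_line[of "x - 1" y A] by (simp add: algebra_simps)
  have 3: "y + x + 1 \<in> diag_line A (y - x + 1) \<longleftrightarrow> (x, y + 1) \<in> A"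
    using mem_iff_diag_line[of x "y + 1" A] by (simp add: algebra_simps)
  have 4: "y + x - 1 \<in> diag_line A (y - x - 1) \<longleftrightarrow> (x, y - 1) \<in> A"
    using mem_iff_diag_line[of x "y - 1" A] by (simp add: algebra_simps)
  show ?thesis
    unfolding mem_iff_diag_line[symmetric] Diff_iff Un_iff widen_def mem_Collect_eq 1 2 3 4 mem_bdry_iff
    by blast
qed

text \<open>No neighbour of a point lies on its own line, so line u only subtracts, and both
  adjacent lines act on it through the same map \<open>widen\<close>.\<close>

lemma diag_line_bdry:
  "diag_line (bdry A) u = (widen (diag_line A (u - 1)) \<union> widen (diag_line A (u + 1))) - diag_line A u"
proof -
  have "v \<in> diag_line (bdry A) u \<longleftrightarrow>
      v \<in> (widen (diag_line A (u - 1)) \<union> widen (diag_line A (u + 1))) - diag_line A u" for v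
  proof (cases "even (u + v)")
    case True
    then obtain x y where "u = y - x" "v = y + x" by (rule diag_coordinates)
    then show ?thesis using mem_diag_line_bdry_aux[of y x A] by simp
  next
    case False
    then have "v \<notin> diag_line (bdry A) u" using diag_line_parity by blast
    moreover have "v \<notin> widen (diag_line A (u - 1))" "v \<notin> widen (diag_line A (u + 1))"
      using False by (auto simp: widen_def dest!: diag_line_parity)
    ultimately show ?thesis by blast
  qed
  then show ?thesis by blast
qed

lemma diag_line_image: "diag_line A u = (\<lambda>(x, y). y + x) ` {(x, y) \<in> A. y - x = u}"
  by (force simp: diag_line_def)

lemma finite_diag_line: "finite A \<Longrightarrow> finite (diag_line A u)"
  unfolding diag_line_image by (rule finite_imageI) (auto intro: finite_subset)

lemma inj_diag: "inj_on (\<lambda>(x :: int, y). (y - x, y + x)) A"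
  by (auto simp: inj_on_def)

lemma diag_image:
  assumes "\<And>u. u \<notin> U \<Longrightarrow> diag_line A u = {}"
  shows "(\<lambda>(x, y). (y - x, y + x)) ` A = (SIGMA u:U. diag_line A u)"
proof -
  have "(y - x, y + x) \<in> (SIGMA u:U. diag_line A u)" if "(x, y) \<in> A" for x y
    using that assms[of "y - x"] unfolding mem_iff_diag_line[of x y A] by auto
  moreover have "(u, v) \<in> (\<lambda>(x, y). (y - x, y + x)) ` A" if "v \<in> diag_line A u" for u v
    using that by (force simp: diag_line_def)
  ultimately show ?thesis by auto
qed

lemma card_eq_sum_diag_line:
  assumes "finite A" "finite U" "\<And>u. u \<notin> U \<Longrightarrow> diag_line A u = {}"
  shows "card A = (\<Sum>u\<in>U. card (diag_line A u))"
proof -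
  have "card A = card (SIGMA u:U. diag_line A u)"
    using diag_image[of U A, OF assms(3)] card_image[OF inj_diag, of A] by simp
  also have "\<dots> = (\<Sum>u\<in>U. card (diag_line A u))"
    using assms(2) finite_diag_line[OF assms(1)] by (intro card_SigmaI) auto
  finally show ?thesis .
qed

lemma finite_if_diag_lines:
  assumes "finite U" "\<And>u. u \<notin> U \<Longrightarrow> diag_line A u = {}" "\<And>u. finite (diag_line A u)"
  shows "finite A"
proof (rule finite_imageD[OF _ inj_diag])
  show "finite ((\<lambda>(x, y). (y - x, y + x)) ` A)"
    using diag_image[of U A, OF assms(2)] finite_SigmaI[OF assms(1), of "diag_line A"] assms(3) by simp
qed

text \<open>The window is open: lines \<open>a\<close> and \<open>b\<close> are empty, so sums over
  \<open>{a..b}\<close> also reach the lines just outside the set, where boundary points still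
  occur.\<close>

lemma diag_line_window:
  assumes "finite A"
  obtains a b where "\<And>u. u \<notin> {a<..<b} \<Longrightarrow> diag_line A u = {}"
proof -
  have "finite ((\<lambda>(x, y). y - x) ` A)" using assms by simp
  then obtain k where "\<And>u. u \<in> (\<lambda>(x, y). y - x) ` A \<Longrightarrow> \<bar>u\<bar> \<le> k"
    by (metis finite_abs_int_segment finite_imageI imageI Max_ge)
  then have k: "\<bar>y - x\<bar> \<le> \<bar>k\<bar>" if "(x, y) \<in> A" for x y using that by force
  show thesis
  proof (rule that[of "- \<bar>k\<bar> - 1" "\<bar>k\<bar> + 1"])
    fix u assume "u \<notin> {- \<bar>k\<bar> - 1<..<\<bar>k\<bar> + 1}"
    then show "diag_line A u = {}" using k by (fastforce simp: diag_line_def)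
  qed
qed

subsection \<open>Compression along diagonals\<close>

text \<open>The least size of \<open>widen X\<close> for a set of n elements. The empty line reaches
  nothing, whence the separate value at 0.\<close>

definition spread :: "nat \<Rightarrow> nat" where
  "spread n = (if n = 0 then 0 else n + 1)"

text \<open>The number of boundary points that the line sizes alone force on line u. Truncated
  subtraction is intended: a line longer than the reach of its neighbours costs nothing.\<close>

definition line_cost :: "(int \<Rightarrow> nat) \<Rightarrow> int \<Rightarrow> nat" where
  "line_cost s u = max (spread (s (u - 1))) (spread (s (u + 1))) - s u"

lemma widen_eq: "widen X = (\<lambda>v. v + 1) ` X \<union> (\<lambda>v. v - 1) ` X"
  by (force simp: widen_def image_iff)

lemma finite_widen: "finite X \<Longrightarrow> finite (widen X)"
  by (simp add: widen_eq)

lemma widen_empty [simp]: "widen {} = {}"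
  by (simp add: widen_def)

text \<open>After the shift by 1, the point v - 1 is new exactly if v starts a maximal run of step
  2. The excess thus counts the runs.\<close>

lemma card_widen:
  assumes "finite X"
  shows "card (widen X) = card X + card {v \<in> X. v - 2 \<notin> X}"
proof -
  have "widen X = (\<lambda>v. v + 1) ` X \<union> (\<lambda>v. v - 1) ` {v \<in> X. v - 2 \<notin> X}"
    by (force simp: widen_eq image_iff)
  also have "card \<dots> = card ((\<lambda>v. v + 1) ` X) + card ((\<lambda>v. v - 1) ` {v \<in> X. v - 2 \<notin> X})"
  proof (rule card_Un_disjoint)
    show "(\<lambda>v. v + 1) ` X \<inter> (\<lambda>v. v - 1) ` {v \<in> X. v - 2 \<notin> X} = {}"
    proof -
      have False if "v \<in> X" "w \<in> X" "w - 2 \<notin> X" "v + 1 = w - 1" for v w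
      proof -
        have "v = w - 2" using that(4) by simp
        with that show False by simp
      qed
      then show ?thesis by blast
    qed
  qed (use assms in auto)
  also have "\<dots> = card X + card {v \<in> X. v - 2 \<notin> X}"
    by (simp add: card_image inj_on_def)
  finally show ?thesis .
qed

lemma Min_step2:
  fixes X :: "int set"
  assumes "finite X" "X \<noteq> {}"
  shows "Min X \<in> {v \<in> X. v - 2 \<notin> X}"
  using Min_le[OF assms(1), of "Min X - 2"] Min_in[OF assms] by auto

lemma spread_le_card_widen:
  assumes "finite X"
  shows "spread (card X) \<le> card (widen X)"
proof (cases "X = {}")
  case False
  have "finite {v \<in> X. v - 2 \<notin> X}" using assms by simp
  then have "card {v \<in> X. v - 2 \<notin> X} > 0"
    using Min_step2[OF assms False] card_gt_0_iff by blast
  then show ?thesis by (simp add: card_widen[OF assms] spread_def)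
qed (simp add: spread_def)

definition parity_interval :: "int \<Rightarrow> int \<Rightarrow> int \<Rightarrow> int set" where
  "parity_interval l r u = {v. l \<le> v \<and> v \<le> r \<and> even (u + v)}"

lemma finite_parity_interval [simp]: "finite (parity_interval l r u)"
  by (rule finite_subset[of _ "{l..r}"]) (auto simp: parity_interval_def)

text \<open>By \<open>card_widen\<close> there is a single run, so stepping down by 2 from the
  maximum can only stop at the minimum.\<close>

lemma interval_if_card_widen:
  assumes fin: "finite X" and ne: "X \<noteq> {}" and card: "card (widen X) \<le> card X + 1"
    and par: "\<And>v. v \<in> X \<Longrightarrow> even (u + v)"
  obtains l r where "l \<in> X" "r \<in> X" "l \<le> r" "X = parity_interval l r u"
proof -
  have "card {v \<in> X. v - 2 \<notin> X} \<le> Suc 0" using card card_widen[OF fin] by simp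
  moreover have "finite {v \<in> X. v - 2 \<notin> X}" using fin by simp
  ultimately have one: "\<forall>v\<in>{v \<in> X. v - 2 \<notin> X}. \<forall>w\<in>{v \<in> X. v - 2 \<notin> X}. v = w"
    using card_le_Suc0_iff_eq by blast
  have down: "v - 2 \<in> X" if "v \<in> X" "v \<noteq> Min X" for v
    using one Min_step2[OF fin ne] that by blast
  have steps: "Max X - 2 * int k \<in> X" if "Max X - 2 * int k \<ge> Min X" for k
    using that
  proof (induction k)
    case 0 then show ?case using fin ne by simp
  next
    case (Suc k)
    then have "Max X - 2 * int k \<in> X" "Max X - 2 * int k \<noteq> Min X" by auto
    from down[OF this] show ?case by (simp add: algebra_simps)
  qed
  have "v \<in> X" if "Min X \<le> v" "v \<le> Max X" "even (u + v)" for v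
  proof -
    have "even (u + Max X)" using par Max_in[OF fin ne] by blast
    with that(3) have "even (Max X - v)" by presburger
    then obtain j where j: "Max X - v = 2 * j" by blast
    then have "v = Max X - 2 * int (nat j)" using that(2) by simp
    then show ?thesis using steps[of "nat j"] that(1) by simp
  qed
  then have "X = parity_interval (Min X) (Max X) u"
    using fin par by (auto simp: parity_interval_def)
  moreover have "Min X \<le> Max X" using Min_le[OF fin Max_in[OF fin ne]] .
  ultimately show thesis using that Min_in[OF fin ne] Max_in[OF fin ne] by blast
qed

text \<open>The half-open window from -n to n has n integers of each parity. One formula therefore
  serves lines of both parities, and the sets are nested in n.\<close>

definition centred :: "int \<Rightarrow> nat \<Rightarrow> int set" where
  "centred u n = {v. even (u + v) \<and> - int n < v \<and> v \<le> int n}"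

lemma finite_centred [simp]: "finite (centred u n)"
  by (rule finite_subset[of _ "{- int n..int n}"]) (auto simp: centred_def)

lemma card_centred: "card (centred u n) = n"
proof (induction n)
  case 0
  have "centred u 0 = {}" by (auto simp: centred_def)
  then show ?case by simp
next
  case (Suc n)
  \<comment> \<open>The window grows by the two integers -n and n + 1, which have opposite parities;
    \<open>w\<close> is the one that fits line u.\<close>
  define w where "w = (if even (u + int n) then - int n else int n + 1)"
  have "centred u (Suc n) = insert w (centred u n)"
    unfolding centred_def w_def by (auto; presburger)
  moreover have "w \<notin> centred u n" by (auto simp: centred_def w_def)
  ultimately show ?case using Suc by simp
qed

lemma centred_mono: "m \<le> n \<Longrightarrow> centred u m \<subseteq> centred u n"
  by (auto simp: centred_def)

lemma widen_centred:
  assumes "odd (u - u')"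
  shows "widen (centred u n) = centred u' (spread n)"
proof (cases "n = 0")
  case False
  have "(even (u + (v - 1)) \<and> - int n < v - 1 \<and> v - 1 \<le> int n \<or>
         even (u + (v + 1)) \<and> - int n < v + 1 \<and> v + 1 \<le> int n) \<longleftrightarrow>
        even (u' + v) \<and> - int (spread n) < v \<and> v \<le> int (spread n)" for v
    using assms False unfolding spread_def by simp presburger
  then show ?thesis unfolding widen_def centred_def mem_Collect_eq by blast
qed (auto simp: widen_def centred_def spread_def)

text \<open>Centred sets are nested, so the union of the two reaches is the larger one and the
  difference to line u is as small as the sizes permit.\<close>

lemma exists_compressed:
  assumes "\<And>u. u \<notin> {a<..<b} \<Longrightarrow> s u = 0"
  obtains C where "finite C" "card C = (\<Sum>u\<in>{a..b}. s u)"
    "card (bdry C) = (\<Sum>u\<in>{a..b}. line_cost s u)"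
proof -
  define C where "C = of_lines (\<lambda>u. centred u (s u))"
  have line: "diag_line C u = centred u (s u)" for u
    by (auto simp: C_def diag_line_of_lines) (auto simp: centred_def)
  have empty: "diag_line C u = {}" if "u \<notin> {a<..<b}" for u
    unfolding line assms[OF that] by (auto simp: centred_def)
  have finC: "finite C"
    by (rule finite_if_diag_lines[of "{a<..<b}"]) (use empty in \<open>auto simp: line\<close>)
  have cardC: "card C = (\<Sum>u\<in>{a..b}. s u)"
    using card_eq_sum_diag_line[OF finC, of "{a..b}", simplified line card_centred] empty[unfolded line]
    by force
  have bline: "diag_line (bdry C) u =
      centred u (max (spread (s (u - 1))) (spread (s (u + 1)))) - centred u (s u)" for u
  proof -
    have "widen (centred (u - 1) n) = centred u (spread n)"
      "widen (centred (u + 1) n) = centred u (spread n)" for n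
      by (intro widen_centred; simp)+
    moreover have "centred u m \<union> centred u n = centred u (max m n)" for m n
      using centred_mono[of m n u] centred_mono[of n m u] by (auto simp: max_def)
    ultimately show ?thesis by (simp add: diag_line_bdry line)
  qed
  have bcard: "card (diag_line (bdry C) u) = line_cost s u" for u
  proof -
    have "card (centred u m - centred u n) = m - n" for m n
    proof (cases "n \<le> m")
      case True
      then show ?thesis using centred_mono[OF True] by (simp add: card_Diff_subset card_centred)
    next
      case False
      then have "centred u m - centred u n = {}" using centred_mono[of m n u] by auto
      then show ?thesis using False by simp
    qed
    then show ?thesis by (simp add: bline line_cost_def)
  qed
  have "diag_line (bdry C) u = {}" if "u \<notin> {a..b}" for u
  proof -
    have "diag_line C (u - 1) = {}" "diag_line C (u + 1) = {}" using that by (auto intro!: empty)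
    then show ?thesis by (simp add: diag_line_bdry)
  qed
  then have "card (bdry C) = (\<Sum>u\<in>{a..b}. line_cost s u)"
    using card_eq_sum_diag_line[OF finite_bdry[OF finC], of "{a..b}"] by (simp add: bcard)
  with finC cardC show thesis by (rule that)
qed

abbreviation line_card :: "vertex set \<Rightarrow> int \<Rightarrow> nat" where
  "line_card A u \<equiv> card (diag_line A u)"

lemma line_cost_le:
  assumes "finite A"
  shows "line_cost (line_card A) u \<le> card (diag_line (bdry A) u)"
proof -
  let ?X = "diag_line A (u - 1)" and ?Y = "diag_line A u" and ?Z = "diag_line A (u + 1)"
  have fin: "finite ?X" "finite ?Y" "finite ?Z" using assms by (simp_all add: finite_diag_line)
  have "card (widen W) - card ?Y \<le> card ((widen ?X \<union> widen ?Z) - ?Y)" if "W = ?X \<or> W = ?Z" for W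
  proof -
    have "card (widen W) - card ?Y \<le> card (widen W - ?Y)"
      by (rule diff_card_le_card_Diff[OF fin(2)])
    also have "\<dots> \<le> card ((widen ?X \<union> widen ?Z) - ?Y)"
      using that fin by (intro card_mono) (auto simp: finite_widen)
    finally show ?thesis .
  qed
  from this[of ?X] this[of ?Z] spread_le_card_widen[OF fin(1)] spread_le_card_widen[OF fin(3)]
  show ?thesis by (simp add: line_cost_def diag_line_bdry)
qed

lemma card_bdry_eq_sum:
  assumes "finite A" "\<And>u. u \<notin> {a<..<b} \<Longrightarrow> diag_line A u = {}"
  shows "card (bdry A) = (\<Sum>u\<in>{a..b}. card (diag_line (bdry A) u))"
proof (rule card_eq_sum_diag_line[OF finite_bdry[OF assms(1)]])
  fix u assume "u \<notin> {a..b}"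
  then have "diag_line A (u - 1) = {}" "diag_line A (u + 1) = {}" by (auto intro!: assms(2))
  then show "diag_line (bdry A) u = {}" by (simp add: diag_line_bdry)
qed simp

lemma sum_line_cost_le:
  assumes "finite A" "\<And>u. u \<notin> {a<..<b} \<Longrightarrow> diag_line A u = {}"
  shows "(\<Sum>u\<in>{a..b}. line_cost (line_card A) u) \<le> card (bdry A)"
  using card_bdry_eq_sum[of A a b, OF assms] sum_mono[OF line_cost_le[OF assms(1)], where K = "{a..b}"] by simp

lemma minimal_le:
  "minimal A \<Longrightarrow> finite C \<Longrightarrow> card C = card A \<Longrightarrow> card (bdry A) \<le> card (bdry C)"
  by (simp add: minimal_def)

lemma minimal_finite: "minimal A \<Longrightarrow> finite A"
  by (simp add: minimal_def)

text \<open>Compressing a minimal set cannot lower its boundary, so every single diagonal is tight.\<close>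

lemma minimal_line_cost_eq:
  assumes "minimal A"
  shows "card (diag_line (bdry A) u) = line_cost (line_card A) u"
proof -
  note fin = minimal_finite[OF assms]
  obtain a b where ab: "\<And>u. u \<notin> {a<..<b} \<Longrightarrow> diag_line A u = {}"
    using diag_line_window[OF fin] by metis
  then have "\<And>u. u \<notin> {a<..<b} \<Longrightarrow> line_card A u = 0" by simp
  then obtain C where C: "finite C" "card C = (\<Sum>u\<in>{a..b}. line_card A u)"
    "card (bdry C) = (\<Sum>u\<in>{a..b}. line_cost (line_card A) u)"
    by (rule exists_compressed)
  have "card A = (\<Sum>u\<in>{a..b}. line_card A u)"
    using ab by (intro card_eq_sum_diag_line[OF fin]) auto
  then have "card (bdry A) \<le> card (bdry C)" using C by (intro minimal_le[OF assms]) auto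
  then have eq: "(\<Sum>u\<in>{a..b}. card (diag_line (bdry A) u)) = (\<Sum>u\<in>{a..b}. line_cost (line_card A) u)"
    using sum_line_cost_le[of A a b, OF fin ab] C(3) card_bdry_eq_sum[of A a b, OF fin ab] by simp
  show ?thesis
  proof (cases "u \<in> {a..b}")
    case True
    show ?thesis
    proof (rule ccontr)
      assume "\<not> ?thesis"
      then have "line_cost (line_card A) u < card (diag_line (bdry A) u)"
        using line_cost_le[OF fin, of u] by simp
      then have "(\<Sum>u\<in>{a..b}. line_cost (line_card A) u) < (\<Sum>u\<in>{a..b}. card (diag_line (bdry A) u))"
        using True by (intro sum_strict_mono_ex1) (auto intro: line_cost_le[OF fin])
      with eq show False by simp
    qed
  next
    case False
    then have "diag_line A (u - 1) = {}" "diag_line A (u + 1) = {}" by (auto intro!: ab)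
    then show ?thesis by (simp add: diag_line_bdry line_cost_def spread_def)
  qed
qed

section \<open>Local shape of a minimal set\<close>

lemma widen_parity_interval:
  assumes "l \<le> r" "even (u + l)" "even (u + r)" "odd (u - u')"
  shows "widen (parity_interval l r u) = parity_interval (l - 1) (r + 1) u'"
proof -
  have "(l \<le> v - 1 \<and> v - 1 \<le> r \<and> even (u + (v - 1)) \<or> l \<le> v + 1 \<and> v + 1 \<le> r \<and> even (u + (v + 1)))
      \<longleftrightarrow> l - 1 \<le> v \<and> v \<le> r + 1 \<and> even (u' + v)" for v
    using assms by presburger
  then show ?thesis unfolding widen_def parity_interval_def mem_Collect_eq by blast
qed

text \<open>If the line at \<open>u + d\<close> is at least as long as the next two, it alone
  determines the cost of line u. Tightness then says that it is one run, that its reach covers line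
  u, and that the line on the other side reaches nothing further. The sign \<open>d\<close> treats
  both directions at once.\<close>

lemma minimal_larger_neighbour:
  assumes min: "minimal A" and d: "d = 1 \<or> d = -1"
    and ne: "diag_line A (u + d) \<noteq> {}"
    and ge: "line_card A u \<le> line_card A (u + d)" "line_card A (u - d) \<le> line_card A (u + d)"
  obtains l r where "l \<in> diag_line A (u + d)" "r \<in> diag_line A (u + d)" "l \<le> r"
    "diag_line A (u + d) = parity_interval l r (u + d)"
    "diag_line A u \<subseteq> parity_interval (l - 1) (r + 1) u"
    "diag_line A (u - d) \<subseteq> diag_line A (u + d)"
proof -
  let ?X = "diag_line A (u - d)" and ?Y = "diag_line A u" and ?Z = "diag_line A (u + d)"
  have fin: "finite ?X" "finite ?Y" "finite ?Z"
    using minimal_finite[OF min] by (simp_all add: finite_diag_line)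
  note finw = fin[THEN finite_widen]
  have "diag_line (bdry A) u = (widen ?X \<union> widen ?Z) - ?Y"
    using d by (auto simp: diag_line_bdry)
  moreover have "line_cost (line_card A) u = max (spread (card ?X)) (spread (card ?Z)) - card ?Y"
    using d by (auto simp: line_cost_def max.commute)
  moreover have "card ?Z > 0" using ne fin by (simp add: card_gt_0_iff)
  ultimately have cost: "card ((widen ?X \<union> widen ?Z) - ?Y) = card ?Z + 1 - card ?Y"
    using minimal_line_cost_eq[OF min, of u] ge by (simp add: spread_def max_def split: if_splits)
  have split: "card (widen ?Z) = card (widen ?Z - ?Y) + card (widen ?Z \<inter> ?Y)"
    using finw(3) by (metis add.commute card_Int_Diff)
  have mono: "card (widen ?Z - ?Y) \<le> card ((widen ?X \<union> widen ?Z) - ?Y)"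
    using finw by (intro card_mono) auto
  have cap: "card (widen ?Z \<inter> ?Y) \<le> card ?Y" using fin by (intro card_mono) auto
  have lower: "card ?Z + 1 \<le> card (widen ?Z)"
    using spread_le_card_widen[OF fin(3)] \<open>card ?Z > 0\<close> by (simp add: spread_def)
  \<comment> \<open>With Y, Z for lines u and u + d: |Z| + 1 \<le> |widen Z| = |widen Z - Y| +
    |widen Z \<inter> Y| \<le> (|Z| + 1 - |Y|) + |Y|, so every inequality is an equality.\<close>
  have "card (widen ?Z \<inter> ?Y) = card ?Y" "card (widen ?Z) \<le> card ?Z + 1"
    "card (widen ?Z - ?Y) = card ((widen ?X \<union> widen ?Z) - ?Y)"
    using split mono cap lower cost ge by linarith+
  then have Y: "?Y \<subseteq> widen ?Z" and Zint: "card (widen ?Z) \<le> card ?Z + 1"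
    and "widen ?Z - ?Y = (widen ?X \<union> widen ?Z) - ?Y"
    using fin finw card_subset_eq[of ?Y "widen ?Z \<inter> ?Y"]
      card_subset_eq[of "(widen ?X \<union> widen ?Z) - ?Y" "widen ?Z - ?Y"] by auto
  then have X: "widen ?X \<subseteq> widen ?Z" by blast
  obtain l r where lr: "l \<in> ?Z" "r \<in> ?Z" "l \<le> r" "?Z = parity_interval l r (u + d)"
    using interval_if_card_widen[OF fin(3) ne Zint] diag_line_parity by metis
  have wZ: "widen ?Z = parity_interval (l - 1) (r + 1) u"
    using widen_parity_interval[of l r "u + d" u] lr diag_line_parity[OF lr(1)]
      diag_line_parity[OF lr(2)] d by auto
  have "?X \<subseteq> ?Z"
  proof
    fix v assume v: "v \<in> ?X"
    then have "v - 1 \<in> widen ?X" "v + 1 \<in> widen ?X" by (auto simp: widen_def)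
    with X have "v - 1 \<in> widen ?Z" "v + 1 \<in> widen ?Z" by auto
    moreover have "even (u + d + v)" using diag_line_parity[OF v] d by auto
    ultimately show "v \<in> ?Z" unfolding wZ by (subst lr(4)) (auto simp: parity_interval_def)
  qed
  with lr Y wZ that show thesis by blast
qed

text \<open>A strictly longest line has room for the reach n + 1 of either neighbour. Its cost is 0,
  so by tightness it carries no boundary point.\<close>

lemma minimal_peak:
  assumes min: "minimal A"
    and gt: "line_card A (u - 1) < line_card A u" "line_card A (u + 1) < line_card A u"
  shows "widen (diag_line A (u - 1)) \<subseteq> diag_line A u" "widen (diag_line A (u + 1)) \<subseteq> diag_line A u"
proof -
  have "line_cost (line_card A) u = 0" using gt by (auto simp: line_cost_def spread_def)
  then have "card (diag_line (bdry A) u) = 0" using minimal_line_cost_eq[OF min] by simp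
  then have "diag_line (bdry A) u = {}"
    using finite_diag_line[OF finite_bdry[OF minimal_finite[OF min]]] by simp
  then show "widen (diag_line A (u - 1)) \<subseteq> diag_line A u" "widen (diag_line A (u + 1)) \<subseteq> diag_line A u"
    unfolding diag_line_bdry by blast+
qed

section \<open>Monotonicity of the least boundary in the size\<close>

text \<open>Remove a point of maximal second coordinate: the point above it leaves the boundary, as
  nothing else touches it, and only the removed point itself can enter.\<close>

lemma exists_subset_bdry_le:
  assumes "finite C" "n \<le> card C"
  obtains D where "D \<subseteq> C" "card D = n" "card (bdry D) \<le> card (bdry C)"
proof -
  have "\<exists>D\<subseteq>C. card D = n \<and> card (bdry D) \<le> card (bdry C)"
    using assms
  proof (induction "card C" arbitrary: C)
    case 0
    then show ?case by (intro exI[of _ C]) simp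
  next
    case (Suc m)
    show ?case
    proof (cases "n = card C")
      case False
      have ne: "C \<noteq> {}" using Suc.hyps(2) by auto
      define y where "y = Max (snd ` C)"
      have "y \<in> snd ` C" unfolding y_def using Suc.prems(1) ne by (intro Max_in) auto
      then obtain x where xy: "(x, y) \<in> C" by force
      have top: "y' \<le> y" if "(x', y') \<in> C" for x' y'
        unfolding y_def using Suc.prems(1) that by (intro Max_ge) force+
      let ?D = "C - {(x, y)}"
      have "(x, y + 1) \<in> bdry C" using xy top[of x "y + 1"] by (auto simp: mem_bdry_iff)
      moreover have "bdry ?D \<subseteq> insert (x, y) (bdry C - {(x, y + 1)})"
      proof -
        have "(x, y + 1) \<notin> bdry ?D"
          using top[of _ "y + 1"] top[of _ "2 + y"] by (auto simp: mem_bdry_iff)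
        then show ?thesis by (auto simp: bdry_def)
      qed
      ultimately have "card (bdry ?D) \<le> card (bdry C)"
        using card_mono[of "insert (x, y) (bdry C - {(x, y + 1)})" "bdry ?D"] finite_bdry[OF Suc.prems(1)]
        by (auto simp: card_insert_if card_Diff_singleton card_gt_0_iff split: if_splits)
           (metis Suc_pred card_gt_0_iff empty_iff)+
      moreover have "m = card ?D" "finite ?D" "n \<le> card ?D"
        using Suc.hyps(2) Suc.prems xy False by (auto simp: card_Diff_singleton)
      ultimately show ?thesis using Suc.hyps(1)[of ?D] by (meson Diff_subset le_trans subset_trans)
    qed auto
  qed
  then show thesis using that by blast
qed

lemma minimal_bdry_le:
  assumes "minimal A" "finite C" "card A \<le> card C"
  shows "card (bdry A) \<le> card (bdry C)"
proof -
  obtain D where "D \<subseteq> C" "card D = card A" "card (bdry D) \<le> card (bdry C)"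
    using exists_subset_bdry_le[OF assms(2,3)] by blast
  then show ?thesis using minimal_le[OF assms(1), of D] assms(2) finite_subset by fastforce
qed

subsection \<open>The isoperimetric inequality\<close>

lemma card_support_Suc:
  fixes s :: "int \<Rightarrow> nat"
  assumes "a \<le> u"
  shows "card {i \<in> {a..u + 1}. s i > 0} =
      card {i \<in> {a..u}. s i > 0} + (if s (u + 1) > 0 then 1 else 0)"
proof -
  have "{i \<in> {a..u + 1}. s i > 0} =
      (if s (u + 1) > 0 then insert (u + 1) {i \<in> {a..u}. s i > 0} else {i \<in> {a..u}. s i > 0})"
    using assms by (auto simp: order_le_less)
  moreover have "finite {i \<in> {a..u}. s i > 0}" by (rule finite_subset[of _ "{a..u}"]) auto
  moreover have "u + 1 \<notin> {i \<in> {a..u}. s i > 0}" by auto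
  ultimately show ?thesis by (simp only: card_insert_disjoint split: if_split) simp
qed

text \<open>Charge the cost of line i to line i + 1 only and telescope:
  \<open>spread (s (i + 1)) - s i\<close> pays for the growth and 1 for each nonempty line. At a
  drop from a nonempty to an empty line the telescoped term is negative but the cost is not, which
  gains the last summand.\<close>

lemma half_cost:
  fixes s :: "int \<Rightarrow> nat"
  assumes "s a = 0" "a \<le> u"
  shows "s u + card {i \<in> {a..u}. s i > 0} + (if \<exists>i\<in>{a..<u}. s i > 0 \<and> s (i + 1) = 0 then 1 else 0)
    \<le> (\<Sum>i\<in>{a..<u}. line_cost s i)"
  using assms(2)
proof (induction u rule: int_ge_induct)
  case base
  then show ?case using assms(1) by (auto simp: card_eq_0_iff)
next
  case (step u)
  have sum: "(\<Sum>i\<in>{a..<u + 1}. line_cost s i) = line_cost s u + (\<Sum>i\<in>{a..<u}. line_cost s i)"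
  proof -
    have "{a..<u + 1} = insert u {a..<u}" using step.hyps by auto
    then show ?thesis by simp
  qed
  have cost: "spread (s (u + 1)) \<le> line_cost s u + s u" by (simp add: line_cost_def)
  note num = card_support_Suc[OF step.hyps, of s]
  define g where "g \<longleftrightarrow> (\<exists>i\<in>{a..<u}. s i > 0 \<and> s (i + 1) = 0)"
  have gap: "(\<exists>i\<in>{a..<u + 1}. s i > 0 \<and> s (i + 1) = 0) \<longleftrightarrow>
      (s u > 0 \<and> s (u + 1) = 0) \<or> (\<exists>i\<in>{a..<u}. s i > 0 \<and> s (i + 1) = 0)"
  proof -
    have "{a..<u + 1} = insert u {a..<u}" using step.hyps by auto
    then show ?thesis by simp
  qed
  show ?case using step.IH cost unfolding sum num gap g_def[symmetric]
    by (cases "s u > 0"; cases "s (u + 1) > 0"; cases g) (simp_all add: spread_def)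
qed

text \<open>Twice the sum is the two end lines plus the sums of adjacent pairs. Without gaps there
  is one pair fewer than nonempty lines, and a pair has at most 2 M - 1 points since not both of its
  lines have size M.\<close>

lemma half_sum:
  fixes s :: "int \<Rightarrow> nat" and M :: nat
  assumes "s a = 0" "a \<le> u" and le: "\<And>i. s i \<le> M"
    and no_gap: "\<And>i. i \<in> {a..<u} \<Longrightarrow> s i > 0 \<Longrightarrow> s (i + 1) > 0"
    and no_adj: "\<And>i. s i = M \<Longrightarrow> s (i + 1) \<noteq> M" and "s u > 0"
  shows "2 * int (\<Sum>i\<in>{a..u}. s i) \<le>
    int (s u) + (int (card {i \<in> {a..u}. s i > 0}) - 1) * (2 * int M - 1) + int M"
proof -
  \<comment> \<open>The first conjunct covers the stretch before the set begins: without gaps, an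
    empty line has only empty lines to its left.\<close>
  have "(s u = 0 \<longrightarrow> (\<forall>i\<in>{a..u}. s i = 0)) \<and> (s u > 0 \<longrightarrow>
    2 * int (\<Sum>i\<in>{a..u}. s i) \<le>
    int (s u) + (int (card {i \<in> {a..u}. s i > 0}) - 1) * (2 * int M - 1) + int M)"
    using assms(2) no_gap
  proof (induction u rule: int_ge_induct)
    case base
    then show ?case using assms(1) by auto
  next
    case (step u)
    have IH: "(s u = 0 \<longrightarrow> (\<forall>i\<in>{a..u}. s i = 0)) \<and> (s u > 0 \<longrightarrow>
      2 * int (\<Sum>i\<in>{a..u}. s i) \<le>
      int (s u) + (int (card {i \<in> {a..u}. s i > 0}) - 1) * (2 * int M - 1) + int M)"
      using step.IH step.prems by simp
    have win: "{a..u + 1} = insert (u + 1) {a..u}" using step.hyps by auto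
    note num = card_support_Suc[OF step.hyps, of s]
    show ?case
    proof (cases "s u = 0")
      case True
      then have z: "\<forall>i\<in>{a..u}. s i = 0" using IH by blast
      then have empty: "{i \<in> {a..u}. s i > 0} = {}" and "(\<Sum>i\<in>{a..u}. s i) = 0" by auto
      then have sum: "(\<Sum>i\<in>{a..u + 1}. s i) = s (u + 1)" unfolding win by simp
      have "card {i \<in> {a..u + 1}. s i > 0} = 1" if "s (u + 1) > 0"
        unfolding num empty using that by simp
      moreover have "\<forall>i\<in>{a..u + 1}. s i = 0" if "s (u + 1) = 0" using z that unfolding win by simp
      ultimately show ?thesis unfolding sum using le[of "u + 1"] by simp
    next
      case False
      then have pos: "s (u + 1) > 0" using step.prems[of u] step.hyps by simp
      have pair: "int (s u) + int (s (u + 1)) \<le> 2 * int M - 1"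
        using le[of u] le[of "u + 1"] no_adj[of u] by linarith
      have "2 * int (\<Sum>i\<in>{a..u + 1}. s i) = 2 * int (\<Sum>i\<in>{a..u}. s i) + 2 * int (s (u + 1))"
        unfolding win by simp
      also have "\<dots> \<le> int (s (u + 1)) + (int (card {i \<in> {a..u}. s i > 0}) - 1) * (2 * int M - 1)
          + int M + (2 * int M - 1)"
        using IH False pair by simp
      also have "\<dots> = int (s (u + 1)) + (int (card {i \<in> {a..u + 1}. s i > 0}) - 1) * (2 * int M - 1) + int M"
        unfolding num using pos by (simp add: algebra_simps)
      finally show ?thesis using pos by simp
    qed
  qed
  then show ?thesis using assms by blast
qed

lemma line_cost_reflect: "line_cost (\<lambda>i. s (- i)) i = line_cost s (- i)"
proof -
  have "- (i - 1) = - i + 1" "- (i + 1) = - i - 1" by auto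
  then show ?thesis unfolding line_cost_def by (simp only: max.commute)
qed

lemma isoperimetric:
  assumes fin: "finite C" and ne: "C \<noteq> {}"
  shows "8 * int (card C) \<le> (int (card (bdry C)) - 2)\<^sup>2 + 4"
proof -
  obtain a b where win: "\<And>u. u \<notin> {a<..<b} \<Longrightarrow> diag_line C u = {}"
    using diag_line_window[OF fin] by metis
  define s where "s = line_card C"
  define n where "n = (\<Sum>i\<in>{a..b}. s i)"
  define k where "k = (\<Sum>i\<in>{a..b}. line_cost s i)"
  define N where "N = card {i \<in> {a..b}. s i > 0}"
  have out: "s u = 0" if "u \<notin> {a<..<b}" for u using win[OF that] by (simp add: s_def)
  have nC: "card C = n" unfolding n_def s_def using win by (intro card_eq_sum_diag_line[OF fin]) auto
  have kC: "k \<le> card (bdry C)" unfolding k_def s_def by (rule sum_line_cost_le[OF fin win])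
  define M where "M = Max (s ` {a..b})"
  have le: "s i \<le> M" for i
  proof (cases "i \<in> {a..b}")
    case False
    then show ?thesis using out[of i] by force
  qed (simp add: M_def)
  have "n > 0" using fin ne by (simp add: card_gt_0_iff flip: nC)
  then have "\<exists>i\<in>{a..b}. s i \<noteq> 0" unfolding n_def by (rule contrapos_pp) simp
  then obtain i where "i \<in> {a..b}" "s i > 0" by blast
  then have Mpos: "M > 0" using le[of i] by simp
  have "M \<in> s ` {a..b}" unfolding M_def using \<open>i \<in> {a..b}\<close> by (intro Max_in) auto
  then obtain u0 where u0: "s u0 = M" by blast
  define right_gap where "right_gap u \<longleftrightarrow> (\<exists>i\<in>{u<..b}. s i > 0 \<and> s (i - 1) = 0)" for u
  define left_gap where "left_gap u \<longleftrightarrow> (\<exists>i\<in>{a..<u}. s i > 0 \<and> s (i + 1) = 0)" for u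
  have inw: "u \<in> {a<..<b}" if "s u = M" for u using out[of u] that Mpos by force
  have numbers: "card {i \<in> {a..u}. s i > 0} + card {i \<in> {u..b}. s i > 0} = N + 1" if "s u = M" for u
  proof -
    have "{i \<in> {a..u}. s i > 0} \<union> {i \<in> {u..b}. s i > 0} = {i \<in> {a..b}. s i > 0}"
      "{i \<in> {a..u}. s i > 0} \<inter> {i \<in> {u..b}. s i > 0} = {u}"
      using inw[OF that] that Mpos by auto
    moreover have "finite {i \<in> {p..q}. s i > 0}" for p q
      by (rule finite_subset[of _ "{p..q}"]) auto
    ultimately show ?thesis
      using card_Un_Int[of "{i \<in> {a..u}. s i > 0}" "{i \<in> {u..b}. s i > 0}"] by (simp add: N_def)
  qed
  have refl_card: "card {i \<in> {- b..- u}. s (- i) > 0} = card {i \<in> {u..b}. s i > 0}" for u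
    by (rule bij_betw_same_card[of uminus], rule bij_betw_byWitness[of _ uminus]) auto
  \<comment> \<open>The two halves are estimated by \<open>half_cost\<close>, the right one after
    reflection. A longest line counts in both, whence 2 M and N + 1.\<close>
  have bound: "2 * M + N + 1 + line_cost s u + (if left_gap u then 1 else 0) + (if right_gap u then 1 else 0) \<le> k"
    if "s u = M" for u
  proof -
    have l: "M + card {i \<in> {a..u}. s i > 0} + (if left_gap u then 1 else 0) \<le> (\<Sum>i\<in>{a..<u}. line_cost s i)"
      using half_cost[of s a u] out[of a] inw[OF that] that by (simp add: left_gap_def)
    have "M + card {i \<in> {- b..- u}. s (- i) > 0} +
        (if \<exists>i\<in>{- b..<- u}. s (- i) > 0 \<and> s (- (i + 1)) = 0 then 1 else 0)
      \<le> (\<Sum>i\<in>{- b..<- u}. line_cost (\<lambda>i. s (- i)) i)"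
      using half_cost[of "\<lambda>i. s (- i)" "- b" "- u"] out[of b] inw[OF that] that by simp
    moreover have "(\<exists>i\<in>{- b..<- u}. s (- i) > 0 \<and> s (- (i + 1)) = 0) \<longleftrightarrow> right_gap u"
    proof
      assume "right_gap u"
      then obtain i where "i \<in> {u<..b}" "s i > 0" "s (i - 1) = 0" by (auto simp: right_gap_def)
      then show "\<exists>i\<in>{- b..<- u}. s (- i) > 0 \<and> s (- (i + 1)) = 0"
        by (intro bexI[of _ "- i"]) (auto simp: algebra_simps)
    next
      assume "\<exists>i\<in>{- b..<- u}. s (- i) > 0 \<and> s (- (i + 1)) = 0"
      then obtain i where "i \<in> {- b..<- u}" "s (- i) > 0" "s (- (i + 1)) = 0" by blast
      moreover have "- (i + 1) = - i - 1" by simp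
      ultimately show "right_gap u" unfolding right_gap_def
        by (intro bexI[of _ "- i"]) auto
    qed
    moreover have "(\<Sum>i\<in>{- b..<- u}. line_cost (\<lambda>i. s (- i)) i) = (\<Sum>i\<in>{u<..b}. line_cost s i)"
      by (rule sum.reindex_bij_witness[of _ uminus uminus]) (auto simp: line_cost_reflect)
    ultimately have r: "M + card {i \<in> {u..b}. s i > 0} + (if right_gap u then 1 else 0)
        \<le> (\<Sum>i\<in>{u<..b}. line_cost s i)"
      by (simp only: refl_card)
    have "{a..b} = {a..<u} \<union> insert u {u<..b}" using inw[OF that] by auto
    then have "k = (\<Sum>i\<in>{a..<u}. line_cost s i) + (\<Sum>i\<in>insert u {u<..b}. line_cost s i)"
      unfolding k_def by (simp only:) (rule sum.union_disjoint, auto)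
    then show ?thesis using l r numbers[OF that] by simp
  qed
  have square: "4 * (p * q) \<le> (int k - 2)\<^sup>2" if "p + q \<le> int k - 2" "0 \<le> p" "0 \<le> q" for p q :: int
  proof -
    have "4 * (p * q) \<le> (p + q)\<^sup>2"
      using zero_le_power2[of "p - q"] by (simp add: power2_eq_square algebra_simps)
    also have "\<dots> \<le> (int k - 2)\<^sup>2" using that by (intro power_mono) auto
    finally show ?thesis .
  qed
  have k2: "2 \<le> k" using bound[OF u0] Mpos by simp
  have "8 * int n \<le> (int k - 2)\<^sup>2 + 4"
  \<comment> \<open>With a unit to spare, n \<le> N M and the square inequality for N and 2 M
    suffice. Otherwise k = 2 M + N + 1, so there are no gaps and no two adjacent longest lines,
    since each would cost one more. Then \<open>half_sum\<close> gives 2 n \<le> N (2 M - 1) + 1,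
    which uses the factors N and 2 M - 1; the final 1 becomes the 4 of the statement.\<close>
  proof (cases "2 * M + N + 2 \<le> k")
    case True
    have "n = (\<Sum>i\<in>{i \<in> {a..b}. s i > 0}. s i)"
      unfolding n_def by (intro sum.mono_neutral_right) auto
    also have "\<dots> \<le> N * M" unfolding N_def by (rule sum_bounded_above[where K = M, simplified]) (rule le)
    finally have "8 * int n \<le> 4 * (int N * (2 * int M))" by (simp flip: of_nat_mult)
    also have "\<dots> \<le> (int k - 2)\<^sup>2" by (rule square) (use True in auto)
    finally show ?thesis by simp
  next
    case False
    with bound[OF u0] have ng: "\<not> left_gap u0" "\<not> right_gap u0" by (auto split: if_splits)
    have no_adj: "s (i + 1) \<noteq> M" if "s i = M" for i
    proof
      assume "s (i + 1) = M"
      then have "line_cost s i \<ge> 1" using that Mpos by (simp add: line_cost_def spread_def)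
      with bound[OF that] False show False by simp
    qed
    let ?l = "card {i \<in> {a..u0}. s i > 0}" and ?r = "card {i \<in> {u0..b}. s i > 0}"
    have l: "2 * int (\<Sum>i\<in>{a..u0}. s i) \<le> int M + (int ?l - 1) * (2 * int M - 1) + int M"
    proof -
      have "s (i + 1) > 0" if "i \<in> {a..<u0}" "s i > 0" for i
        using ng(1) that unfolding left_gap_def by (meson gr0I)
      then show ?thesis
        using half_sum[of s a u0 M] out[of a] inw[OF u0] le no_adj u0 Mpos by simp
    qed
    have "2 * int (\<Sum>i\<in>{- b..- u0}. s (- i)) \<le>
        int M + (int (card {i \<in> {- b..- u0}. s (- i) > 0}) - 1) * (2 * int M - 1) + int M"
    proof -
      have "s (- (i + 1)) > 0" if "i \<in> {- b..<- u0}" "s (- i) > 0" for i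
      proof -
        have "- i \<in> {u0<..b}" "- i - 1 = - (i + 1)" using that(1) by auto
        then show ?thesis using ng(2) that(2) unfolding right_gap_def by (metis gr0I)
      qed
      moreover have "s (- (i + 1)) \<noteq> M" if "s (- i) = M" for i
        using no_adj[of "- (i + 1)"] that by auto
      ultimately show ?thesis
        using half_sum[of "\<lambda>i. s (- i)" "- b" "- u0" M] out[of b] inw[OF u0] le u0 Mpos by simp
    qed
    moreover have "(\<Sum>i\<in>{- b..- u0}. s (- i)) = (\<Sum>i\<in>{u0..b}. s i)"
      by (rule sum.reindex_bij_witness[of _ uminus uminus]) auto
    ultimately have r: "2 * int (\<Sum>i\<in>{u0..b}. s i) \<le> int M + (int ?r - 1) * (2 * int M - 1) + int M"
      by (simp only: refl_card)
    have "{a..b} = {a..u0} \<union> {u0<..b}" "{u0..b} = insert u0 {u0<..b}" using inw[OF u0] by auto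
    then have "n = (\<Sum>i\<in>{a..u0}. s i) + (\<Sum>i\<in>{u0<..b}. s i)"
      "(\<Sum>i\<in>{u0..b}. s i) = M + (\<Sum>i\<in>{u0<..b}. s i)"
      unfolding n_def using u0 by (simp_all add: sum.union_disjoint ivl_disj_int_two)
    then have "n + M = (\<Sum>i\<in>{a..u0}. s i) + (\<Sum>i\<in>{u0..b}. s i)" by simp
    then have "2 * int n \<le> (int ?l + int ?r - 2) * (2 * int M - 1) + 2 * int M"
    proof -
      have "(int ?l + int ?r - 2) * (2 * int M - 1) =
          (int ?l - 1) * (2 * int M - 1) + (int ?r - 1) * (2 * int M - 1)"
        by (simp add: algebra_simps)
      moreover have "int n + int M = int (\<Sum>i\<in>{a..u0}. s i) + int (\<Sum>i\<in>{u0..b}. s i)"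
        using \<open>n + M = _\<close> by linarith
      ultimately show ?thesis using l r by linarith
    qed
    also have "int ?l + int ?r - 2 = int N - 1" using numbers[OF u0] by linarith
    finally have "2 * int n \<le> int N * (2 * int M - 1) + 1" by (simp add: algebra_simps)
    moreover have "4 * (int N * (2 * int M - 1)) \<le> (int k - 2)\<^sup>2"
      by (rule square) (use bound[OF u0] Mpos in auto)
    ultimately show ?thesis by linarith
  qed
  also have "\<dots> \<le> (int (card (bdry C)) - 2)\<^sup>2 + 4" using kC k2 by (simp add: power_mono)
  finally show ?thesis by (simp add: nC)
qed

subsection \<open>Saturated minimal sets are boxes\<close>

text \<open>Closing the gap saves the cost of the empty lines in it, at least the larger of the two
  adjacent sizes plus 1, and adds cost only on the two lines that now touch. Minimality forbids a
  net saving, which leaves just the pattern of two single points around one empty line.\<close>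

lemma gap_lines:
  assumes min: "minimal A" and ne: "diag_line A p \<noteq> {}" "diag_line A q \<noteq> {}" and pq: "p + 1 < q"
    and empty: "\<And>i. p < i \<Longrightarrow> i < q \<Longrightarrow> diag_line A i = {}"
  shows "q = p + 2" "line_card A p = 1" "line_card A q = 1"
    "diag_line A (p - 1) = {}" "diag_line A (q + 1) = {}"
proof -
  note fin = minimal_finite[OF min]
  obtain a b where win: "\<And>u. u \<notin> {a<..<b} \<Longrightarrow> diag_line A u = {}"
    using diag_line_window[OF fin] by metis
  define s where "s = line_card A"
  have out: "s u = 0" if "u \<notin> {a<..<b}" for u using win[OF that] by (simp add: s_def)
  have zero: "s i = 0" if "p < i" "i < q" for i using empty[OF that] by (simp add: s_def)
  have pos: "s p > 0" "s q > 0" using ne by (simp_all add: s_def card_gt_0_iff finite_diag_line[OF fin])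
  have ab: "a < p" "q < b" using pos out[of p] out[of q] by force+
  define j where "j = q - p - 1"
  have j: "j \<ge> 1" using pq by (simp add: j_def)
  \<comment> \<open>closing the gap by moving the part beyond it\<close>
  define t where "t i = (if i \<le> p then s i else s (i + j))" for i
  have t_out: "t u = 0" if "u \<notin> {a<..<b}" for u
    using that ab j by (auto simp: t_def intro!: out)
  have shift: "(\<Sum>i\<in>{m<..b}. f (i + j)) = (\<Sum>i\<in>{m + j<..b}. f i)"
    if "\<And>i. b < i \<Longrightarrow> f i = 0" for f :: "int \<Rightarrow> nat" and m
  proof -
    have "(\<Sum>i\<in>{m<..b}. f (i + j)) = (\<Sum>i\<in>{m + j<..b + j}. f i)"
      by (rule sum.reindex_bij_witness[of _ "\<lambda>i. i - j" "\<lambda>i. i + j"]) auto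
    also have "\<dots> = (\<Sum>i\<in>{m + j<..b}. f i)"
      using j that by (intro sum.mono_neutral_right) auto
    finally show ?thesis .
  qed
  have split: "(\<Sum>i\<in>{a..b}. f i) = (\<Sum>i\<in>{a..<p}. f i) + f p + (\<Sum>i\<in>{p<..b}. f i)" for f :: "int \<Rightarrow> nat"
  proof -
    have "{a..b} = {a..<p} \<union> insert p {p<..b}" using ab pq by auto
    then have "sum f {a..b} = sum f {a..<p} + sum f (insert p {p<..b})"
      by (simp only:) (rule sum.union_disjoint, auto)
    then show ?thesis by simp
  qed
  have split': "(\<Sum>i\<in>{p<..b}. f i) = (\<Sum>i\<in>{p<..<q}. f i) + f q + (\<Sum>i\<in>{q<..b}. f i)" for f :: "int \<Rightarrow> nat"
  proof -
    have "{p<..b} = {p<..<q} \<union> insert q {q<..b}" using ab pq by auto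
    then have "sum f {p<..b} = sum f {p<..<q} + sum f (insert q {q<..b})"
      by (simp only:) (rule sum.union_disjoint, auto)
    then show ?thesis by simp
  qed
  have split'': "(\<Sum>i\<in>{p<..b}. f i) = f (p + 1) + (\<Sum>i\<in>{p + 1<..b}. f i)" for f :: "int \<Rightarrow> nat"
  proof -
    have "{p<..b} = insert (p + 1) {p + 1<..b}" using ab pq by auto
    then show ?thesis by simp
  qed
  have "(\<Sum>i\<in>{a..b}. t i) = (\<Sum>i\<in>{a..b}. s i)"
  proof -
    have "(\<Sum>i\<in>{p<..b}. t i) = (\<Sum>i\<in>{p<..b}. s (i + j))" by (intro sum.cong) (auto simp: t_def)
    also have "\<dots> = (\<Sum>i\<in>{p + j<..b}. s i)" by (rule shift) (auto intro: out)
    also have "\<dots> = (\<Sum>i\<in>{p<..b}. s i)"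
      using j by (intro sum.mono_neutral_left) (auto simp: j_def intro: zero)
    finally show ?thesis unfolding split by (simp add: t_def)
  qed
  moreover obtain C where C: "finite C" "card C = (\<Sum>u\<in>{a..b}. t u)"
    "card (bdry C) = (\<Sum>u\<in>{a..b}. line_cost t u)"
    using exists_compressed[of a b t] t_out by blast
  moreover have "card A = (\<Sum>u\<in>{a..b}. s u)"
    unfolding s_def using win by (intro card_eq_sum_diag_line[OF fin]) auto
  ultimately have "card (bdry A) \<le> (\<Sum>u\<in>{a..b}. line_cost t u)"
    using minimal_le[OF min C(1)] by simp
  moreover have "card (bdry A) = (\<Sum>u\<in>{a..b}. line_cost s u)"
    using card_bdry_eq_sum[of A a b, OF fin win] by (simp add: s_def minimal_line_cost_eq[OF min])
  moreover have "(\<Sum>i\<in>{a..<p}. line_cost t i) = (\<Sum>i\<in>{a..<p}. line_cost s i)"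
    by (intro sum.cong) (auto simp: line_cost_def t_def)
  moreover have "(\<Sum>i\<in>{p + 1<..b}. line_cost t i) = (\<Sum>i\<in>{q<..b}. line_cost s i)"
  proof -
    have "(\<Sum>i\<in>{p + 1<..b}. line_cost t i) = (\<Sum>i\<in>{p + 1<..b}. line_cost s (i + j))"
      by (intro sum.cong) (auto simp: line_cost_def t_def algebra_simps)
    also have "\<dots> = (\<Sum>i\<in>{p + 1 + j<..b}. line_cost s i)"
      by (rule shift) (simp add: line_cost_def spread_def out)
    finally show ?thesis by (simp add: j_def)
  qed
  moreover have "(\<Sum>i\<in>{a..b}. line_cost s i) = (\<Sum>i\<in>{a..<p}. line_cost s i) + line_cost s p +
      ((\<Sum>i\<in>{p<..<q}. line_cost s i) + line_cost s q + (\<Sum>i\<in>{q<..b}. line_cost s i))"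
    by (simp only: split split')
  moreover have "(\<Sum>i\<in>{a..b}. line_cost t i) = (\<Sum>i\<in>{a..<p}. line_cost t i) + line_cost t p +
      (line_cost t (p + 1) + (\<Sum>i\<in>{p + 1<..b}. line_cost t i))"
    by (simp only: split split'')
  \<comment> \<open>Elsewhere the two profiles have equal costs, so only lines p to q before the
    move and lines p and p + 1 after it remain to be compared.\<close>
  ultimately have le: "line_cost s p + (\<Sum>i\<in>{p<..<q}. line_cost s i) + line_cost s q
      \<le> line_cost t p + line_cost t (p + 1)"
    by linarith
  have tp: "t (p - 1) = s (p - 1)" "t p = s p" "t (p + 1) = s q" "t (2 + p) = s (q + 1)"
    by (auto simp: t_def j_def algebra_simps)
  have costs: "line_cost t p = max (spread (s (p - 1))) (s q + 1) - s p"
    "line_cost t (p + 1) = max (s p + 1) (spread (s (q + 1))) - s q"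
    "line_cost s p = spread (s (p - 1)) - s p" "line_cost s q = spread (s (q + 1)) - s q"
    using pos pq tp zero[of "p + 1"] zero[of "q - 1"] by (simp_all add: line_cost_def spread_def)
  have near: "line_cost s (p + 1) \<ge> s p + 1" "line_cost s (q - 1) \<ge> s q + 1"
    using pos pq zero[of "p + 1"] zero[of "q - 1"] by (simp_all add: line_cost_def spread_def)
  have q: "q = p + 2"
  proof (rule ccontr)
    assume "q \<noteq> p + 2"
    then have "p + 1 \<noteq> q - 1" using pq by simp
    then have "line_cost s (p + 1) + line_cost s (q - 1) = sum (line_cost s) {p + 1, q - 1}" by simp
    also have "\<dots> \<le> (\<Sum>i\<in>{p<..<q}. line_cost s i)" using pq by (intro sum_mono2) auto
    finally have "s p + s q + 2 \<le> (\<Sum>i\<in>{p<..<q}. line_cost s i)" using near by linarith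
    with le costs pos show False by linarith
  qed
  then have "{p<..<q} = {p + 1}" "q - 1 = p + 1" by auto
  then have "(\<Sum>i\<in>{p<..<q}. line_cost s i) = line_cost s (p + 1)" "line_cost s (q - 1) = line_cost s (p + 1)"
    by (simp, simp only:)
  then have "max (s p) (s q) + 1 \<le> (\<Sum>i\<in>{p<..<q}. line_cost s i)" using near by linarith
  with le costs pos have "s p = 1 \<and> s q = 1 \<and> spread (s (p - 1)) \<le> 1 \<and> spread (s (q + 1)) \<le> 1"
    by linarith
  then show "line_card A p = 1" "line_card A q = 1" "diag_line A (p - 1) = {}" "diag_line A (q + 1) = {}"
    using finite_diag_line[OF fin] by (auto simp: spread_def s_def split: if_splits)
  show "q = p + 2" by (rule q)
qed

text \<open>Emptiness of a line does not mark the end of the set. It does force the surroundings,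
  which the walk along the lines and the matching of the two sides need.\<close>

lemma empty_line:
  assumes min: "minimal A" and "diag_line A w = {}" "diag_line A p \<noteq> {}" "p < w"
    "diag_line A q \<noteq> {}" "w < q"
  shows "line_card A (w - 1) = 1" "line_card A (w + 1) = 1"
    "diag_line A (w - 2) = {}" "diag_line A (w + 2) = {}"
proof -
  obtain a b where win: "\<And>u. u \<notin> {a<..<b} \<Longrightarrow> diag_line A u = {}"
    using diag_line_window[OF minimal_finite[OF min]] by metis
  define P where "P = {i \<in> {a<..<b}. diag_line A i \<noteq> {} \<and> i < w}"
  define Q where "Q = {i \<in> {a<..<b}. diag_line A i \<noteq> {} \<and> w < i}"
  have fin: "finite P" "finite Q"
    unfolding P_def Q_def by (rule finite_subset[of _ "{a<..<b}"], blast, simp)+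
  have "p \<in> P" "q \<in> Q" using assms win[of p] win[of q] unfolding P_def Q_def by blast+
  then have P: "Max P \<in> P" and Q: "Min Q \<in> Q" using fin Max_in Min_in by blast+
  have between: "diag_line A i = {}" if "Max P < i" "i < Min Q" for i
  proof (rule ccontr)
    assume ne: "diag_line A i \<noteq> {}"
    then have "i \<in> {a<..<b}" using win by blast
    moreover have "i \<noteq> w" using ne assms(2) by auto
    ultimately have "i \<in> P \<or> i \<in> Q" using ne unfolding P_def Q_def by force
    then show False using Max_ge[OF fin(1)] Min_le[OF fin(2)] that by fastforce
  qed
  have "Max P < w" "diag_line A (Max P) \<noteq> {}" using P unfolding P_def by blast+
  moreover have "w < Min Q" "diag_line A (Min Q) \<noteq> {}" using Q unfolding Q_def by blast+
  ultimately have g: "Min Q = Max P + 2" "line_card A (Max P) = 1" "line_card A (Min Q) = 1"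
    "diag_line A (Max P - 1) = {}" "diag_line A (Min Q + 1) = {}"
    using gap_lines[OF min, of "Max P" "Min Q"] between by auto
  then have "Max P = w - 1" "Min Q = w + 1" using \<open>Max P < w\<close> \<open>w < Min Q\<close> by linarith+
  with g show "line_card A (w - 1) = 1" "line_card A (w + 1) = 1"
    "diag_line A (w - 2) = {}" "diag_line A (w + 2) = {}" by (simp_all add: algebra_simps)
qed

section \<open>Filling lines in saturated sets\<close>

lemma card_parity_interval:
  assumes "c \<le> d + 1"
  shows "2 * int (card (parity_interval c d u)) =
    d - c + 1 + (if even (d - c) then if even (u + c) then 1 else - 1 else 0)"
proof -
  have "c - 1 \<le> d" using assms by simp
  then show ?thesis
  proof (induction d rule: int_ge_induct)
    case base
    have "parity_interval c (c - 1) u = {}" by (auto simp: parity_interval_def)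
    then show ?case by simp
  next
    case (step d)
    show ?case
    proof (cases "even (u + (d + 1))")
      case True
      have "parity_interval c (d + 1) u = insert (d + 1) (parity_interval c d u)"
        using True step.hyps by (auto simp: parity_interval_def)
      moreover have "d + 1 \<notin> parity_interval c d u" by (simp add: parity_interval_def)
      ultimately have "card (parity_interval c (d + 1) u) = card (parity_interval c d u) + 1" by simp
      then show ?thesis using step.IH True by (auto split: if_splits)
    next
      case False
      then have "parity_interval c (d + 1) u = parity_interval c d u"
        by (auto simp: parity_interval_def order_le_less)
      then show ?thesis using step.IH False by (auto split: if_splits)
    qed
  qed
qed

text \<open>This spreads \<open>fill\<close> along a line. Only the landing point of a step has to
  lie in the interval, so the seed may lie up to 2 outside.\<close>

lemma step2_closure:
  fixes Y :: "int set"
  assumes y0: "y0 \<in> Y" "lo - 2 \<le> y0" "y0 \<le> hi + 2"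
    and up: "\<And>y. y \<in> Y \<Longrightarrow> lo \<le> y + 2 \<Longrightarrow> y + 2 \<le> hi \<Longrightarrow> y + 2 \<in> Y"
    and down: "\<And>y. y \<in> Y \<Longrightarrow> lo \<le> y - 2 \<Longrightarrow> y - 2 \<le> hi \<Longrightarrow> y - 2 \<in> Y"
    and v: "lo \<le> v" "v \<le> hi" "even (v - y0)"
  shows "v \<in> Y"
proof -
  have upk: "y0 + 2 * int k \<in> Y" if "y0 + 2 * int k \<le> hi" for k
    using that
  proof (induction k)
    case (Suc k)
    then show ?case using up[of "y0 + 2 * int k"] y0 by (simp add: algebra_simps)
  qed (simp add: y0)
  have downk: "y0 - 2 * int k \<in> Y" if "lo \<le> y0 - 2 * int k" for k
    using that
  proof (induction k)
    case (Suc k)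
    then show ?case using down[of "y0 - 2 * int k"] y0 by (simp add: algebra_simps)
  qed (simp add: y0)
  obtain j where j: "v - y0 = 2 * j" using v(3) by blast
  show ?thesis
  proof (cases "0 \<le> j")
    case True
    then have "v = y0 + 2 * int (nat j)" using j by simp
    then show ?thesis using upk[of "nat j"] v by simp
  next
    case False
    then have "v = y0 - 2 * int (nat (- j))" using j by simp
    then show ?thesis using downk[of "nat (- j)"] v by simp
  qed
qed

lemma diag_line_Un: "diag_line (A \<union> C) u = diag_line A u \<union> diag_line C u"
  by (auto simp: diag_line_def)

lemma diag_line_closure:
  "diag_line (A \<union> bdry A) u = diag_line A u \<union> widen (diag_line A (u - 1)) \<union> widen (diag_line A (u + 1))"
  by (auto simp: diag_line_Un diag_line_bdry)

lemma card_bdry_insert_le: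
  assumes "finite A" "p \<in> bdry A" "\<And>r. adj p r \<Longrightarrow> r \<in> A \<union> bdry A \<union> Q" "finite Q"
  shows "card (bdry (insert p A)) + 1 \<le> card (bdry A) + card Q"
proof -
  have "bdry (insert p A) \<subseteq> (bdry A - {p}) \<union> Q"
    using assms(3) by (auto simp: bdry_def adj_sym)
  then have "card (bdry (insert p A)) \<le> card ((bdry A - {p}) \<union> Q)"
    using finite_bdry[OF assms(1)] assms(4) by (intro card_mono) auto
  also have "\<dots> \<le> card (bdry A - {p}) + card Q" by (rule card_Un_le)
  finally show ?thesis using card.remove[OF finite_bdry[OF assms(1)] assms(2)] by simp
qed

text \<open>Every dead set is of this kind: a point added without boundary growth would give a
  minimal set by \<open>minimal_bdry_le\<close>. A locale, because it is also interpreted for the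
  mirror image.\<close>

locale saturated_minimal =
  fixes A :: "vertex set"
  assumes min: "minimal A"
    and saturated: "p \<notin> A \<Longrightarrow> card (bdry A) < card (bdry (insert p A))"
begin

abbreviation X :: "int \<Rightarrow> int set" where "X \<equiv> diag_line A"

abbreviation closure_line :: "int \<Rightarrow> int set" where "closure_line \<equiv> diag_line (A \<union> bdry A)"

lemma fin: "finite A"
  using min by (rule minimal_finite)

text \<open>A point next to \<open>A\<close> all but one of whose neighbours lie in \<open>A\<close> or its boundary could be added for free.\<close>

lemma fill:
  assumes d: "d = 1 \<or> d = -1" and e: "e = 1 \<or> e = -1"
    and "v \<in> closure_line u" "v - e \<in> closure_line (u + d)"
      "v + e \<in> closure_line (u - d)" "v - e \<in> closure_line (u - d)"
  shows "v \<in> X u"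
proof (rule ccontr)
  assume no: "v \<notin> X u"
  obtain x y where xy: "u = y - x" "v = y + x"
    using diag_coordinates[OF diag_line_parity[OF assms(3)]] by blast
  let ?Q = "{r. adj (x, y) r \<and> r \<notin> A \<union> bdry A}"
  have notin: "(x, y) \<notin> A" and bd: "(x, y) \<in> bdry A"
    using no assms(3) by (auto simp: xy mem_iff_diag_line[of x y] diag_line_Un)
  have m: "(x + 1, y) \<in> A \<union> bdry A \<longleftrightarrow> v + 1 \<in> closure_line (u - 1)"
    "(x - 1, y) \<in> A \<union> bdry A \<longleftrightarrow> v - 1 \<in> closure_line (u + 1)"
    "(x, y + 1) \<in> A \<union> bdry A \<longleftrightarrow> v + 1 \<in> closure_line (u + 1)"
    "(x, y - 1) \<in> A \<union> bdry A \<longleftrightarrow> v - 1 \<in> closure_line (u - 1)"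
    unfolding mem_iff_diag_line[of _ _ "A \<union> bdry A"] by (simp_all add: xy algebra_simps)
  have "\<exists>q. ?Q \<subseteq> {q}"
  proof -
    have "?Q = {r \<in> {(x + 1, y), (x - 1, y), (x, y + 1), (x, y - 1)}. r \<notin> A \<union> bdry A}"
      by (auto simp: adj_iff)
    \<comment> \<open>The one neighbour about which nothing is assumed is v + e on line u + d; the
      conditional gives its coordinates.\<close>
    also have "\<dots> \<subseteq> {if d = 1 then if e = 1 then (x, y + 1) else (x - 1, y)
        else if e = 1 then (x + 1, y) else (x, y - 1)}"
      using d e assms(4-6) by (elim disjE) (simp_all add: m[symmetric], blast+)
    finally show ?thesis by blast
  qed
  then obtain q where q: "?Q \<subseteq> {q}" by blast
  then have "finite ?Q" "card ?Q \<le> 1"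
    using finite_subset[OF q] card_mono[OF _ q] by simp_all
  moreover have "card (bdry (insert (x, y) A)) + 1 \<le> card (bdry A) + card ?Q"
    using \<open>finite ?Q\<close> by (intro card_bdry_insert_le[OF fin bd]) blast+
  ultimately have "card (bdry (insert (x, y) A)) \<le> card (bdry A)" by linarith
  with saturated[OF notin] show False by simp
qed

lemma closureI:
  "v \<in> X u \<Longrightarrow> v \<in> closure_line u"
  "v + 1 \<in> X (u + 1) \<Longrightarrow> v \<in> closure_line u"
  "v - 1 \<in> X (u + 1) \<Longrightarrow> v \<in> closure_line u"
  "v + 1 \<in> X (u - 1) \<Longrightarrow> v \<in> closure_line u"
  "v - 1 \<in> X (u - 1) \<Longrightarrow> v \<in> closure_line u"
  by (auto simp: diag_line_closure widen_def)

lemma closureI':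
  "w \<in> X u' \<Longrightarrow> u' = u + 1 \<or> u' = u - 1 \<Longrightarrow> w = v + 1 \<or> w = v - 1 \<Longrightarrow> v \<in> closure_line u"
  using closureI by blast

lemma parity_interval_eqD:
  assumes "parity_interval l r u = parity_interval l' r' u" "l \<in> parity_interval l r u"
    "r \<in> parity_interval l r u" "l' \<in> parity_interval l' r' u" "r' \<in> parity_interval l' r' u"
  shows "l = l'" "r = r'"
proof -
  have "l \<in> parity_interval l' r' u" "r \<in> parity_interval l' r' u" "l' \<in> parity_interval l r u"
    "r' \<in> parity_interval l r u" using assms by blast+
  then show "l = l'" "r = r'" by (auto simp: parity_interval_def)
qed

lemma parity_interval_cong: "even (u - u') \<Longrightarrow> parity_interval l r u = parity_interval l r u'"
  by (auto simp: parity_interval_def)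

lemma next_lines:
  assumes "X w \<noteq> {}" "card (X (w + 1)) \<le> card (X w)" "card (X (w + 2)) \<le> card (X w)"
  shows "\<exists>l r. l \<in> X w \<and> r \<in> X w \<and> l \<le> r \<and> X w = parity_interval l r w \<and>
    X (w + 1) \<subseteq> parity_interval (l - 1) (r + 1) (w + 1) \<and> X (w + 2) \<subseteq> X w"
proof -
  have e: "w + 1 + - 1 = w" "w + 1 - - 1 = w + 2" by auto
  show ?thesis
    by (rule minimal_larger_neighbour[OF min, of "- 1" "w + 1", unfolded e]) (use assms in blast)+
qed

lemma previous_lines:
  assumes "X w \<noteq> {}" "card (X (w - 1)) \<le> card (X w)" "card (X (w - 2)) \<le> card (X w)"
  shows "\<exists>l r. l \<in> X w \<and> r \<in> X w \<and> l \<le> r \<and> X w = parity_interval l r w \<and>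
    X (w - 1) \<subseteq> parity_interval (l - 1) (r + 1) (w - 1) \<and> X (w - 2) \<subseteq> X w"
proof -
  have e: "w - 1 + 1 = w" "w - 1 - 1 = w - 2" by auto
  show ?thesis
    by (rule minimal_larger_neighbour[OF min, of 1 "w - 1", unfolded e]) (use assms in blast)+
qed

text \<open>Line u0 + 1 stays within one step of the longest line and may overhang it at one end.
  \<open>L\<close> and \<open>R\<close> record this overhang; being of the other parity, it does not
  change the interval on line u0. All further lines up to \<open>b\<close> obey the same
  bounds.\<close>

lemma right_side:
  assumes max: "\<And>u. line_card A u \<le> line_card A u0"
    and lr: "l \<in> X u0" "r \<in> X u0" "l \<le> r" and Xu0: "X u0 = parity_interval l r u0"
    and b: "u0 < b" "X b \<noteq> {}"
  obtains L R where "L = l \<and> R = r \<or> L = l \<and> R = r + 1 \<or> L = l - 1 \<and> R = r"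
    "\<And>u. u0 \<le> u \<Longrightarrow> u \<le> b \<Longrightarrow> X u = parity_interval L R u"
proof -
  have par: "even (u0 + l)" "even (u0 + r)" using lr diag_line_parity by blast+
  have ne0: "X u0 \<noteq> {}" using lr by auto
  have sub1: "X (u0 + 1) \<subseteq> parity_interval (l - 1) (r + 1) (u0 + 1)"
  proof -
    obtain l' r' where *: "l' \<in> X u0" "r' \<in> X u0" "X u0 = parity_interval l' r' u0"
      "X (u0 + 1) \<subseteq> parity_interval (l' - 1) (r' + 1) (u0 + 1)"
      using next_lines[OF ne0 max max] by blast
    then have "l' = l" "r' = r" using parity_interval_eqD[of l r u0 l' r'] lr Xu0 by auto
    with * show ?thesis by simp
  qed
  \<comment> \<open>An empty line u0 + 1 occurs only next to a single point, where nothing is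
    claimed. Otherwise any one of its points spreads by \<open>fill\<close>.\<close>
  have inner: "parity_interval (l + 1) (r - 1) (u0 + 1) \<subseteq> X (u0 + 1)"
  proof (cases "X (u0 + 1) = {}")
    case True
    then have "u0 + 1 \<noteq> b" using b by auto
    then have "card (X u0) = 1" using empty_line(1)[OF min True, of u0 b] ne0 b by simp
    then have "l = r" using lr by (metis card_1_singletonE singletonD)
    then show ?thesis by (auto simp: parity_interval_def)
  next
    case False
    then obtain y0 where y0: "y0 \<in> X (u0 + 1)" by blast
    then have y0': "l - 1 \<le> y0" "y0 \<le> r + 1" "even (u0 + 1 + y0)"
      using sub1 by (auto simp: parity_interval_def)
    show ?thesis
    proof
      fix v assume v: "v \<in> parity_interval (l + 1) (r - 1) (u0 + 1)"
      have in0: "x - 1 \<in> X u0" "x + 1 \<in> X u0"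
        if "l + 1 \<le> x" "x \<le> r - 1" "even (u0 + 1 + x)" for x
        using that by (auto simp: Xu0 parity_interval_def)
      show "v \<in> X (u0 + 1)"
      proof (rule step2_closure[OF y0, of "l + 1" "r - 1"])
        fix y assume y: "y \<in> X (u0 + 1)"
        then have ypar: "even (u0 + 1 + y)" by (rule diag_line_parity)
        show "y + 2 \<in> X (u0 + 1)" if "l + 1 \<le> y + 2" "y + 2 \<le> r - 1"
          using in0[OF that] ypar y
          by (intro fill[of 1 1]) (auto intro: closureI'[of _ u0] closureI(1) closureI'[of y "u0 + 1"])
        show "y - 2 \<in> X (u0 + 1)" if "l + 1 \<le> y - 2" "y - 2 \<le> r - 1"
          using in0[OF that] ypar y
          by (intro fill[of 1 "-1"]) (auto intro: closureI'[of _ u0] closureI(1) closureI'[of y "u0 + 1"])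
      qed (use v y0' in \<open>auto simp: parity_interval_def\<close>)
    qed
  qed
  define R where "R = (if r + 1 \<in> X (u0 + 1) then r + 1 else r)"
  define L where "L = (if l - 1 \<in> X (u0 + 1) then l - 1 else l)"
  have cases: "L = l \<and> R = r \<or> L = l \<and> R = r + 1 \<or> L = l - 1 \<and> R = r"
  proof -
    \<comment> \<open>Overhanging at both ends, line u0 + 1 would contain the whole reach of line
      u0, hence exceed the maximal size.\<close>
    have False if both: "r + 1 \<in> X (u0 + 1)" "l - 1 \<in> X (u0 + 1)"
    proof -
      have "parity_interval (l - 1) (r + 1) (u0 + 1) \<subseteq> X (u0 + 1)"
      proof
        fix v assume v: "v \<in> parity_interval (l - 1) (r + 1) (u0 + 1)"
        have "v = l - 1 \<or> v = r + 1 \<or> v \<in> parity_interval (l + 1) (r - 1) (u0 + 1)"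
          using v par unfolding parity_interval_def mem_Collect_eq by presburger
        then show "v \<in> X (u0 + 1)" using both inner by blast
      qed
      then have "widen (X u0) \<subseteq> X (u0 + 1)"
        using widen_parity_interval[of l r u0 "u0 + 1"] lr par by (simp add: Xu0)
      then have "card (widen (X u0)) \<le> card (X (u0 + 1))"
        using finite_diag_line[OF fin] by (intro card_mono) auto
      moreover have "card (X u0) > 0" using ne0 finite_diag_line[OF fin] by (simp add: card_gt_0_iff)
      ultimately show False
        using spread_le_card_widen[OF finite_diag_line[OF fin], of u0] max[of "u0 + 1"]
        by (simp add: spread_def)
    qed
    then show ?thesis by (auto simp: L_def R_def)
  qed
  have X0: "X u0 = parity_interval L R u0"
  proof -
    have "l \<le> v \<and> v \<le> r \<and> even (u0 + v) \<longleftrightarrow> L \<le> v \<and> v \<le> R \<and> even (u0 + v)" for v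
      using cases par by presburger
    then show ?thesis unfolding Xu0 parity_interval_def by blast
  qed
  have X1: "X (u0 + 1) = parity_interval L R (u0 + 1)"
  proof (intro equalityI subsetI)
    fix v assume v: "v \<in> X (u0 + 1)"
    with sub1 have *: "l - 1 \<le> v" "v \<le> r + 1" "even (u0 + 1 + v)" by (auto simp: parity_interval_def)
    have "v \<noteq> l - 1 \<or> L = l - 1" "v \<noteq> r + 1 \<or> R = r + 1" using v by (auto simp: L_def R_def)
    moreover have "v \<noteq> l" "v \<noteq> r" using *(3) par by auto
    ultimately show "v \<in> parity_interval L R (u0 + 1)"
      using * cases by (auto simp: parity_interval_def)
  next
    fix v assume v: "v \<in> parity_interval L R (u0 + 1)"
    then have "v \<noteq> l" "v \<noteq> r" using par by (auto simp: parity_interval_def)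
    then have "v = l - 1 \<and> L = l - 1 \<or> v = r + 1 \<and> R = r + 1 \<or> v \<in> parity_interval (l + 1) (r - 1) (u0 + 1)"
      using v cases by (auto simp: parity_interval_def)
    then show "v \<in> X (u0 + 1)" using inner by (auto simp: L_def R_def split: if_splits)
  qed
  \<comment> \<open>The induction carries all earlier lines, since filling line u + 2 uses both line
    u and line u + 1.\<close>
  have two_steps: "X (u + 2) = parity_interval L R (u + 2)"
    if u: "u0 \<le> u" "u + 2 \<le> b" and IH: "\<And>w. u0 \<le> w \<Longrightarrow> w \<le> u + 1 \<Longrightarrow> X w = parity_interval L R w" for u
  proof (cases "X (u + 2) = {}")
    case True
    then have "u + 2 \<noteq> b" using b by auto
    then have "X u = {}" using empty_line(3)[OF min True, of u0 b] ne0 b u by simp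
    then show ?thesis using True IH[of u] u(1) parity_interval_cong[of u "u + 2" L R] by simp
  next
    case False
    have Xu: "X u = parity_interval L R u" and Xu1: "X (u + 1) = parity_interval L R (u + 1)"
      using IH u by auto
    have e2: "parity_interval L R (u + 2) = parity_interval L R u" by (rule parity_interval_cong) simp
    have pos2: "card (X (u + 2)) > 0" using False finite_diag_line[OF fin] by (simp add: card_gt_0_iff)
    have sub: "X (u + 2) \<subseteq> parity_interval L R (u + 2)"
    proof -
      consider (lower) "card (X (u + 2)) \<le> card (X u)" "card (X (u + 1)) \<le> card (X u)"
        | (peak) "card (X u) < card (X (u + 1))" "card (X (u + 2)) < card (X (u + 1))"
        | (upper) "card (X u) < card (X (u + 2))" "card (X (u + 1)) \<le> card (X (u + 2))"
        by linarith
      then show ?thesis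
      proof cases
        case lower
        then have "X u \<noteq> {}" using pos2 by auto
        then have "X (u + 2) \<subseteq> X u" using next_lines lower by blast
        then show ?thesis unfolding e2 Xu .
      next
        case peak
        then have "widen (X (u + 2)) \<subseteq> X (u + 1)"
          using minimal_peak(2)[OF min, of "u + 1"] by (simp add: add.commute)
        then have "v - 1 \<in> X (u + 1) \<and> v + 1 \<in> X (u + 1)" if "v \<in> X (u + 2)" for v
          using that by (auto simp: widen_def)
        then show ?thesis unfolding Xu1
          by (fastforce simp: parity_interval_def)
      next
        case upper
        \<comment> \<open>Here lines u - 1 and u + 1 equal the longest line and line u + 2 is as
          long, hence a shift of it by one. Then \<open>fill\<close> puts the overhanging end into
          line u, so lines u and u + 2 coincide, against the assumed sizes.\<close>
        have odd: "odd (u - u0)"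
        proof
          assume "even (u - u0)"
          then have "X u = X u0" unfolding Xu X0 by (rule parity_interval_cong)
          with upper max[of "u + 2"] show False by simp
        qed
        then have "u \<noteq> u0" by auto
        then have Xm1: "X (u - 1) = parity_interval L R (u - 1)" using IH[of "u - 1"] u by simp
        have eqs: "X (u - 1) = X u0" "X (u + 1) = X u0"
          unfolding X0 Xm1 Xu1 using odd by (intro parity_interval_cong; simp)+
        obtain l' r' where *: "l' \<in> X (u + 2)" "r' \<in> X (u + 2)" "l' \<le> r'"
          "X (u + 2) = parity_interval l' r' (u + 2)"
          "X (u + 1) \<subseteq> parity_interval (l' - 1) (r' + 1) (u + 1)"
        proof -
          have "u + 2 - 1 = u + 1" "u + 2 - 2 = u" by auto
          then show ?thesis
            using previous_lines[of "u + 2"] upper(2) less_imp_le[OF upper(1)] False that by metis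
        qed
        have par': "even (u + 2 + l')" "even (u + 2 + r')" using *(1,2) diag_line_parity by blast+
        have "card (X (u + 2)) = card (X u0)" using upper(2) eqs max[of "u + 2"] by simp
        then have "r' - l' = r - l"
          using card_parity_interval[of l r u0] card_parity_interval[of l' r' "u + 2"] par par' *(3,4) lr(3) Xu0
          by (simp split: if_splits)
        moreover have "l' - 1 \<le> l" "r \<le> r' + 1"
          using *(5) lr eqs(2) by (auto simp: parity_interval_def)
        ultimately have lr': "l' = l + 1 \<and> r' = r + 1 \<or> l' = l - 1 \<and> r' = r - 1"
          using odd par par' by presburger
        have opar: "odd (u + l)" "odd (u + r)" using odd par by auto
        from lr' show ?thesis
        proof
          assume **: "l' = l + 1 \<and> r' = r + 1"
          have "r + 1 \<in> X u"
            using eqs lr *(2) **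
            by (intro fill[of "-1" 1]) (auto intro: closureI'[of r] closureI'[of "r + 1" "u + 2"] closureI(1))
          then have "R = r + 1 \<and> L = l" using cases unfolding Xu by (auto simp: parity_interval_def)
          then have "v \<in> X u \<longleftrightarrow> v \<in> X (u + 2)" for v
            unfolding *(4) Xu parity_interval_def mem_Collect_eq using opar **
            by (cases "v = l") auto
          then have "X u = X (u + 2)" by blast
          with upper show ?thesis by simp
        next
          assume **: "l' = l - 1 \<and> r' = r - 1"
          have "l - 1 \<in> X u"
            using eqs lr *(1) **
            by (intro fill[of "-1" "-1"]) (auto intro: closureI'[of l] closureI'[of "l - 1" "u + 2"] closureI(1))
          then have "R = r \<and> L = l - 1" using cases unfolding Xu by (auto simp: parity_interval_def)
          then have "v \<in> X u \<longleftrightarrow> v \<in> X (u + 2)" for v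
            unfolding *(4) Xu parity_interval_def mem_Collect_eq using opar **
            by (cases "v = r") auto
          then have "X u = X (u + 2)" by blast
          with upper show ?thesis by simp
        qed
      qed
    qed
    obtain y0 where y0: "y0 \<in> X (u + 2)" using False by blast
    then have y0': "L \<le> y0" "y0 \<le> R" "even (u + 2 + y0)"
      using sub by (auto simp: parity_interval_def)
    have "parity_interval L R (u + 2) \<subseteq> X (u + 2)"
    proof
      fix v assume v: "v \<in> parity_interval L R (u + 2)"
      show "v \<in> X (u + 2)"
      proof (rule step2_closure[OF y0, of L R])
        fix y assume y: "y \<in> X (u + 2)"
        then have y': "L \<le> y" "y \<le> R" "even (u + 2 + y)" using sub by (auto simp: parity_interval_def)
        show "y + 2 \<in> X (u + 2)" if "L \<le> y + 2" "y + 2 \<le> R"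
        proof -
          have "y + 2 \<in> X u" "y + 1 \<in> X (u + 1)" using that y' by (auto simp: Xu Xu1 parity_interval_def)
          then show ?thesis using y
            by (intro fill[of 1 1]) (auto intro: closureI'[of "y + 1"] closureI'[of "y + 2" u]
                closureI'[of y "u + 2"] closureI(1))
        qed
        show "y - 2 \<in> X (u + 2)" if "L \<le> y - 2" "y - 2 \<le> R"
        proof -
          have "y - 2 \<in> X u" "y - 1 \<in> X (u + 1)" using that y' by (auto simp: Xu Xu1 parity_interval_def)
          then show ?thesis using y
            by (intro fill[of 1 "-1"]) (auto intro: closureI'[of "y - 1"] closureI'[of "y - 2" u]
                closureI'[of y "u + 2"] closureI(1))
        qed
      qed (use v y0' in \<open>auto simp: parity_interval_def\<close>)
    qed
    with sub show ?thesis by blast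
  qed
  have "\<forall>w. u0 \<le> w \<and> w \<le> u + 1 \<longrightarrow> X w = parity_interval L R w" if "u0 \<le> u" "u + 1 \<le> b" for u
    using that
  proof (induction u rule: int_ge_induct)
    case base
    show ?case
    proof (intro allI impI)
      fix w assume "u0 \<le> w \<and> w \<le> u0 + 1"
      then have "w = u0 \<or> w = u0 + 1" by auto
      then show "X w = parity_interval L R w" using X0 X1 by auto
    qed
  next
    case (step u)
    then have IH: "\<forall>w. u0 \<le> w \<and> w \<le> u + 1 \<longrightarrow> X w = parity_interval L R w" by simp
    have two: "X (u + 2) = parity_interval L R (u + 2)"
      using step.hyps step.prems IH by (intro two_steps) auto
    show ?case
    proof (intro allI impI)
      fix w assume w: "u0 \<le> w \<and> w \<le> u + 1 + 1"
      then have "w \<le> u + 1 \<or> w = u + 2" by auto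
      then show "X w = parity_interval L R w" using IH two w by auto
    qed
  qed
  from this[of "b - 1"] b(1) have "\<And>u. u0 \<le> u \<Longrightarrow> u \<le> b \<Longrightarrow> X u = parity_interval L R u" by simp
  with cases show thesis by (rule that)
qed

text \<open>The two sides of a longest line \<open>u\<close> overhang it in the same direction.\<close>

lemma overhang_agrees:
  assumes max: "\<And>w. line_card A w \<le> line_card A u"
    and lr: "l \<in> X u" "r \<in> X u" "l \<le> r" and Xu: "X u = parity_interval l r u"
    and d: "d = 1 \<or> d = -1" and e: "e = 1 \<or> e = -1" and z: "z = (if e = 1 then r else l)"
    and side: "L = l \<and> R = r \<or> L = l \<and> R = r + 1 \<or> L = l - 1 \<and> R = r"
      "X (u + d) = parity_interval L R (u + d)"
    and side': "L' = l \<and> R' = r \<or> L' = l \<and> R' = r + 1 \<or> L' = l - 1 \<and> R' = r"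
      "X (u - d) = parity_interval L' R' (u - d)"
    and far: "X w \<noteq> {}" "d * (u - w) > 0"
    and mem: "z + e \<in> X (u + d)"
  shows "z + e \<in> X (u - d)"
proof (rule ccontr)
  assume no: "z + e \<notin> X (u - d)"
  have par: "even (u + l)" "even (u + r)" using lr diag_line_parity by blast+
  have LR: "L = (if e = 1 then l else l - 1) \<and> R = (if e = 1 then r + 1 else r)"
    using side(1) mem e z unfolding side(2) parity_interval_def by auto
  \<comment> \<open>With its overhang, line u + d has maximal size, so it contains line u - d by
    \<open>minimal_larger_neighbour\<close>. An overhang of line u - d at the opposite end is thus
    excluded.\<close>
  have LR': "L' = l \<and> R' = r"
  proof (rule ccontr)
    assume contra: "\<not> ?thesis"
    have "card (X (u + d)) = card (X u)"
      using card_parity_interval[of L R "u + d"] card_parity_interval[of l r u] LR lr(3) par d e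
      by (auto simp: side(2) Xu)
    moreover have "X (u + d) \<noteq> {}" using mem by blast
    ultimately obtain l' where "X (u - d) \<subseteq> X (u + d)" "l' \<in> X (u + d)"
      using minimal_larger_neighbour[OF min d, of u thesis] max by simp
    then have sub: "X (u - d) \<subseteq> X (u + d)" by simp
    have "even (u - d + (r + 1))" "even (u - d + (l - 1))" using par d by auto
    then have mem': "r + 1 \<in> X (u - d) \<longleftrightarrow> R' = r + 1" "l - 1 \<in> X (u - d) \<longleftrightarrow> L' = l - 1"
      using side'(1) lr(3) unfolding side'(2) parity_interval_def mem_Collect_eq by linarith+
    have "(if e = 1 then l - 1 else r + 1) \<in> X (u - d)"
      using e
    proof
      assume "e = 1"
      then show ?thesis using mem' no z contra side'(1) by auto
    next
      assume "e = - 1"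
      then show ?thesis using mem' no z contra side'(1) by auto
    qed
    with sub have "(if e = 1 then l - 1 else r + 1) \<in> X (u + d)" by blast
    with LR e show False unfolding side(2) parity_interval_def by auto
  qed
  show False
  \<comment> \<open>If l = r, line u - d is empty; as \<open>far\<close> provides points beyond it,
    \<open>empty_line\<close> empties line u + d too. If l < r, the missing end point satisfies the
    conditions of \<open>fill\<close>.\<close>
  proof (cases "l = r")
    case True
    have empty: "X (u - d) = {}"
      using LR' True par d unfolding side'(2) parity_interval_def by auto
    have "X (u + d) = {}"
      using d
    proof
      assume d1: "d = 1"
      then have "w < u - 1" using far empty by (cases "w = u - 1") auto
      moreover have "X (u - 1) = {}" "X u \<noteq> {}" using empty d1 lr by auto
      ultimately have "X (u - 1 + 2) = {}" using empty_line(4)[OF min, of "u - 1" w u] far by simp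
      then show ?thesis by (simp add: d1 add.commute)
    next
      assume d1: "d = -1"
      then have "u + 1 < w" using far empty by (cases "w = u + 1") auto
      moreover have "X (u + 1) = {}" "X u \<noteq> {}" using empty d1 lr by auto
      ultimately have "X (u + 1 - 2) = {}" using empty_line(3)[OF min, of "u + 1" u w] far by simp
      then show ?thesis by (simp add: d1)
    qed
    with mem show False by blast
  next
    case False
    then have "l < r" using lr(3) by simp
    moreover have "even (u - d + (r - 1))" "even (u - d + (l + 1))" using par d by auto
    ultimately have ze: "z - e \<in> X (u - d)"
      using e z LR' unfolding side'(2) parity_interval_def by auto
    have zu: "z \<in> X u" using lr z by simp
    have d': "- d = 1 \<or> - d = -1" using d by auto
    have "z + e \<in> closure_line (u - d)" by (rule closureI'[OF zu]) (use d e in auto)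
    moreover have "z + e - e \<in> closure_line (u - d + - d)"
      by (rule closureI'[OF ze]) (use d e in auto)
    moreover have "z + e + e \<in> closure_line (u - d - - d)"
      by (rule closureI'[OF mem]) (use d e in auto)
    moreover have "z + e - e \<in> closure_line (u - d - - d)" using closureI(1)[OF zu] by simp
    ultimately have "z + e \<in> X (u - d)" by (rule fill[OF d' e])
    with no show False ..
  qed
qed

end

section \<open>Symmetries, and both sides of a longest line\<close>

lemma automorphism_bdry_image:
  assumes "automorphism f"
  shows "bdry (f ` A) = f ` bdry A"
proof -
  have bij: "bij f" and adj: "\<And>u v. adj (f u) (f v) \<longleftrightarrow> adj u v" using assms by (auto simp: automorphism_def)
  have "f p \<in> bdry (f ` A) \<longleftrightarrow> p \<in> bdry A" for p
    using adj bij by (auto simp: bdry_def inj_image_mem_iff bij_is_inj)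
  moreover have "\<exists>p. q = f p" for q using bij by (metis bij_pointE)
  ultimately show ?thesis using bij by (fastforce simp: bij_is_inj inj_image_mem_iff)
qed

lemma automorphism_card:
  assumes "automorphism f"
  shows "card (f ` A) = card A"
  using assms unfolding automorphism_def by (metis bij_is_inj card_image inj_on_subset top_greatest)

lemma automorphism_minimal:
  assumes "automorphism f" "minimal A"
  shows "minimal (f ` A)"
  using assms(2) unfolding minimal_def automorphism_bdry_image[OF assms(1)] automorphism_card[OF assms(1)]
  by simp

lemma automorphism_swap: "automorphism prod.swap"
  unfolding automorphism_def adj_def by (simp add: add.commute)

text \<open>The mirror image in u; it turns \<open>right_side\<close> into its counterpart for the
  left.\<close>

lemma diag_line_swap: "diag_line (prod.swap ` A) u = diag_line A (- u)"
proof -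
  have "(x, y) \<in> prod.swap ` A \<longleftrightarrow> (y, x) \<in> A" for x y by force
  then have "diag_line (prod.swap ` A) u = {v. \<exists>x y. (y, x) \<in> A \<and> y - x = u \<and> y + x = v}"
    by (simp add: diag_line_def)
  also have "\<dots> = {v. \<exists>x y. (x, y) \<in> A \<and> x - y = u \<and> x + y = v}" by blast
  also have "\<dots> = diag_line A (- u)"
  proof -
    have "x - y = u \<longleftrightarrow> y - x = - u" "x + y = y + x" for x y by auto
    then show ?thesis unfolding diag_line_def by (simp add: add.commute)
  qed
  finally show ?thesis .
qed

lemma saturated_minimal_swap:
  assumes "saturated_minimal A"
  shows "saturated_minimal (prod.swap ` A)"
proof
  interpret saturated_minimal A by fact
  show "minimal (prod.swap ` A)" by (rule automorphism_minimal[OF automorphism_swap min])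
  fix p assume "p \<notin> prod.swap ` A"
  then have "prod.swap p \<notin> A" by force
  moreover have "insert p (prod.swap ` A) = prod.swap ` insert (prod.swap p) A" by simp
  ultimately show "card (bdry (prod.swap ` A)) < card (bdry (insert p (prod.swap ` A)))"
    using saturated by (simp only: automorphism_bdry_image[OF automorphism_swap] automorphism_card[OF automorphism_swap])
qed

lemma saturated_minimal_is_box:
  assumes "saturated_minimal A"
  shows "is_box A"
proof -
  interpret saturated_minimal A by fact
  interpret S: saturated_minimal "prod.swap ` A" by (rule saturated_minimal_swap[OF assms])
  have ne: "A \<noteq> {}" using min by (simp add: minimal_def)
  define U where "U = (\<lambda>(x, y). y - x) ` A"
  have U: "u \<in> U \<longleftrightarrow> X u \<noteq> {}" for u unfolding U_def diag_line_def by force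
  have finU: "finite U" "U \<noteq> {}" using fin ne by (auto simp: U_def)
  define a b where "a = Min U" and "b = Max U"
  have a: "X a \<noteq> {}" and b: "X b \<noteq> {}" using Min_in[OF finU] Max_in[OF finU] by (auto simp: U a_def b_def)
  have ab: "a \<le> u" "u \<le> b" if "X u \<noteq> {}" for u using that finU by (auto simp: a_def b_def simp flip: U)
  have "Max (line_card A ` U) \<in> line_card A ` U" using finU by (intro Max_in) auto
  then obtain u0 where u0: "u0 \<in> U" "line_card A u0 = Max (line_card A ` U)" by auto
  have max: "line_card A u \<le> line_card A u0" for u
  proof (cases "u \<in> U")
    case False
    then show ?thesis using U by simp
  qed (use finU u0 in simp)
  have ne0: "X u0 \<noteq> {}" using u0 U by blast
  obtain l r where lr: "l \<in> X u0" "r \<in> X u0" "l \<le> r" and Xu0: "X u0 = parity_interval l r u0"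
    using next_lines[OF ne0 max max] by blast
  define side where "side L R \<longleftrightarrow> L = l \<and> R = r \<or> L = l \<and> R = r + 1 \<or> L = l - 1 \<and> R = r" for L R
  have right: "\<exists>L R. side L R \<and> (\<forall>u. u0 \<le> u \<and> u \<le> b \<longrightarrow> X u = parity_interval L R u)" if "u0 < b"
    using right_side[OF max lr Xu0 that b] unfolding side_def by metis
  have left: "\<exists>L R. side L R \<and> (\<forall>u. a \<le> u \<and> u \<le> u0 \<longrightarrow> X u = parity_interval L R u)" if "a < u0"
  proof -
    have flip: "parity_interval L R (- u) = parity_interval L R u" for L R u
      by (rule parity_interval_cong) simp
    have "\<exists>L R. side L R \<and> (\<forall>u. - u0 \<le> u \<and> u \<le> - a \<longrightarrow> S.X u = parity_interval L R u)"
      using S.right_side[of "- u0" l r "- a"] max lr Xu0 a that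
      unfolding side_def diag_line_swap flip minus_minus by (metis neg_less_iff_less)
    then obtain L R where "side L R" and *: "\<And>u. - u0 \<le> u \<Longrightarrow> u \<le> - a \<Longrightarrow> S.X u = parity_interval L R u"
      by blast
    then have "X u = parity_interval L R u" if "a \<le> u" "u \<le> u0" for u
      using *[of "- u"] that by (simp add: diag_line_swap flip)
    with \<open>side L R\<close> show ?thesis by blast
  qed
  have par: "even (u0 + l)" "even (u0 + r)" using lr diag_line_parity by blast+
  have "\<exists>L R. \<forall>u. a \<le> u \<and> u \<le> b \<longrightarrow> X u = parity_interval L R u"
  proof (cases "a < u0 \<and> u0 < b")
    case True
    then obtain L R where s: "side L R" and R: "\<And>u. u0 \<le> u \<Longrightarrow> u \<le> b \<Longrightarrow> X u = parity_interval L R u"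
      using right by blast
    obtain L' R' where s': "side L' R'" and L: "\<And>u. a \<le> u \<Longrightarrow> u \<le> u0 \<Longrightarrow> X u = parity_interval L' R' u"
      using left True by blast
    have sides: "X (u0 + 1) = parity_interval L R (u0 + 1)" "X (u0 - 1) = parity_interval L' R' (u0 - 1)"
      using R[of "u0 + 1"] L[of "u0 - 1"] True by auto
    \<comment> \<open>The two directions are the instances d = 1 and d = -1, with the outermost
      lines a and b as the points beyond.\<close>
    have agree: "z + e \<in> X (u0 + 1) \<longleftrightarrow> z + e \<in> X (u0 - 1)"
      if "e = 1 \<or> e = -1" "z = (if e = 1 then r else l)" for z e
      using overhang_agrees[OF max lr Xu0 _ that, of 1 L R L' R' a] s s' sides a
        overhang_agrees[OF max lr Xu0 _ that, of "-1" L' R' L R b] b True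
      unfolding side_def by auto
    have "r + 1 \<in> X (u0 + 1) \<longleftrightarrow> R = r + 1" "r + 1 \<in> X (u0 - 1) \<longleftrightarrow> R' = r + 1"
      "l - 1 \<in> X (u0 + 1) \<longleftrightarrow> L = l - 1" "l - 1 \<in> X (u0 - 1) \<longleftrightarrow> L' = l - 1"
      using s s' lr(3) par unfolding sides side_def parity_interval_def by auto
    then have "R = r + 1 \<longleftrightarrow> R' = r + 1" "L = l - 1 \<longleftrightarrow> L' = l - 1"
      using agree[of 1 r] agree[of "-1" l] by auto
    then have "L' = L" "R' = R" using s s' unfolding side_def by auto
    then have "X u = parity_interval L R u" if "a \<le> u \<and> u \<le> b" for u
      using R[of u] L[of u] that by (cases "u \<le> u0") auto
    then show ?thesis by blast
  next
    case False
    have "a \<le> u0" "u0 \<le> b" using ab ne0 by auto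
    with False consider "a = u0" "u0 = b" | "a = u0" "u0 < b" | "a < u0" "u0 = b" by linarith
    then show ?thesis
    proof cases
      case 1
      then have "u = u0" if "a \<le> u \<and> u \<le> b" for u using that by simp
      then show ?thesis using Xu0 by blast
    next
      case 2
      then show ?thesis using right by blast
    next
      case 3
      then show ?thesis using left by blast
    qed
  qed
  then obtain L R where LR: "\<And>u. a \<le> u \<Longrightarrow> u \<le> b \<Longrightarrow> X u = parity_interval L R u" by blast
  have "(x, y) \<in> A \<longleftrightarrow> (x, y) \<in> Box4 a b L R" for x y
  proof -
    have "(x, y) \<in> A \<longleftrightarrow> a \<le> y - x \<and> y - x \<le> b \<and> y + x \<in> X (y - x)"
      using ab[of "y - x"] mem_iff_diag_line[of x y A] by auto
    also have "\<dots> \<longleftrightarrow> (x, y) \<in> Box4 a b L R"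
    proof (cases "a \<le> y - x \<and> y - x \<le> b")
      case True
      then have "X (y - x) = parity_interval L R (y - x)" using LR by blast
      with True show ?thesis by (simp add: Box4_def parity_interval_def)
    qed (auto simp: Box4_def)
    finally show ?thesis .
  qed
  then have "A = Box4 a b L R" by auto
  with ne show ?thesis unfolding is_box_def by blast
qed

subsection \<open>Boxes\<close>

lemma diag_line_Box4:
  "diag_line (Box4 a b c d) u = (if a \<le> u \<and> u \<le> b then parity_interval c d u else {})"
proof -
  have "Box4 a b c d = of_lines (\<lambda>u. if a \<le> u \<and> u \<le> b then {c..d} else {})"
    by (auto simp: Box4_def of_lines_def split: if_splits)
  then show ?thesis by (auto simp: diag_line_of_lines parity_interval_def)
qed

lemma finite_Box4 [simp]: "finite (Box4 a b c d)"
  by (rule finite_if_diag_lines[of "{a..b}"]) (auto simp: diag_line_Box4)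

text \<open>The number of pairs in the rectangle with even coordinate sum minus the number with odd
  sum.\<close>

definition box_excess :: "int \<Rightarrow> int \<Rightarrow> int \<Rightarrow> int \<Rightarrow> int" where
  "box_excess a b c d = (if even (b - a) \<and> even (d - c) then if even (a + c) then 1 else - 1 else 0)"

lemma card_Box4:
  assumes "a \<le> b + 1" "c \<le> d + 1"
  shows "2 * int (card (Box4 a b c d)) = (b - a + 1) * (d - c + 1) + box_excess a b c d"
proof -
  have "card (Box4 a b c d) = (\<Sum>u\<in>{a..b}. card (diag_line (Box4 a b c d) u))"
    by (rule card_eq_sum_diag_line) (auto simp: diag_line_Box4)
  also have "\<dots> = (\<Sum>u\<in>{a..b}. card (parity_interval c d u))"
    by (rule sum.cong) (auto simp: diag_line_Box4)
  finally have card: "card (Box4 a b c d) = (\<Sum>u\<in>{a..b}. card (parity_interval c d u))" .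
  have "a - 1 \<le> b" using assms(1) by simp
  then have "2 * int (\<Sum>u\<in>{a..b}. card (parity_interval c d u)) =
      (b - a + 1) * (d - c + 1) + box_excess a b c d"
  proof (induction b rule: int_ge_induct)
    case base
    then show ?case by (simp add: box_excess_def)
  next
    case (step b)
    have "{a..b + 1} = insert (b + 1) {a..b}" using step.hyps by auto
    then have "2 * int (\<Sum>u\<in>{a..b + 1}. card (parity_interval c d u)) =
        2 * int (card (parity_interval c d (b + 1))) + 2 * int (\<Sum>u\<in>{a..b}. card (parity_interval c d u))"
      by simp
    also have "\<dots> = (b - a + 1) * (d - c + 1) + box_excess a b c d +
        (d - c + 1 + (if even (d - c) then if even (b + 1 + c) then 1 else - 1 else 0))"
      using step.IH card_parity_interval[OF assms(2), of "b + 1"] by simp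
    also have "\<dots> = (b + 1 - a + 1) * (d - c + 1) + box_excess a (b + 1) c d"
      by (auto simp: box_excess_def algebra_simps)
    finally show ?case .
  qed
  with card show ?thesis by simp
qed

lemma bdry_Box4_subset: "bdry (Box4 a b c d) \<subseteq> Box4 (a - 1) (b + 1) (c - 1) (d + 1) - Box4 a b c d"
  unfolding subset_iff split_paired_All mem_bdry_iff Diff_iff by (auto simp: Box4_def)

text \<open>Enlarging the rectangle by one on each side keeps the excess, which cancels: half of (p
  + 2)(q + 2) - p q is p + q + 2.\<close>

lemma card_frame:
  assumes "a \<le> b" "c \<le> d"
  shows "int (card (Box4 (a - 1) (b + 1) (c - 1) (d + 1) - Box4 a b c d)) = b - a + (d - c) + 4"
proof -
  have "Box4 a b c d \<subseteq> Box4 (a - 1) (b + 1) (c - 1) (d + 1)" by (auto simp: Box4_def)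
  then have "int (card (Box4 (a - 1) (b + 1) (c - 1) (d + 1) - Box4 a b c d)) =
      int (card (Box4 (a - 1) (b + 1) (c - 1) (d + 1))) - int (card (Box4 a b c d))"
    by (simp add: card_Diff_subset card_mono of_nat_diff)
  moreover have "box_excess (a - 1) (b + 1) (c - 1) (d + 1) = box_excess a b c d"
    by (simp add: box_excess_def)
  then have "2 * int (card (Box4 (a - 1) (b + 1) (c - 1) (d + 1))) =
      (b - a + 3) * (d - c + 3) + box_excess a b c d"
    using card_Box4[of "a - 1" "b + 1" "c - 1" "d + 1"] assms by (simp add: algebra_simps)
  moreover have "2 * int (card (Box4 a b c d)) = (b - a + 1) * (d - c + 1) + box_excess a b c d"
    using card_Box4[of a b c d] assms by simp
  ultimately show ?thesis by (simp add: algebra_simps)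
qed

lemma card_bdry_Box4_le:
  assumes "a \<le> b" "c \<le> d"
  shows "int (card (bdry (Box4 a b c d))) \<le> b - a + (d - c) + 4"
  using card_mono[OF _ bdry_Box4_subset[of a b c d]] card_frame[OF assms] by simp

text \<open>All four bounds are attained by points of the box. This is automatic in a direction
  across which the width is positive; across width 0 only one parity is available.\<close>

definition tight_box :: "int \<Rightarrow> int \<Rightarrow> int \<Rightarrow> int \<Rightarrow> bool" where
  "tight_box a b c d \<longleftrightarrow> a \<le> b \<and> c \<le> d \<and> (c < d \<or> even (a + c) \<and> even (b + c)) \<and>
    (a < b \<or> even (a + c) \<and> even (a + d))"

text \<open>The signs for u and v can be chosen independently to step into the box. This could fail
  only if the box has width 0 in a coordinate and the frame point already has that value, which
  parity excludes.\<close>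

lemma card_bdry_tight_box:
  assumes "tight_box a b c d"
  shows "int (card (bdry (Box4 a b c d))) = b - a + (d - c) + 4"
proof -
  have "(x, y) \<in> bdry (Box4 a b c d)"
    if "(x, y) \<in> Box4 (a - 1) (b + 1) (c - 1) (d + 1) - Box4 a b c d" for x y
  proof -
    obtain u v where uv: "u = y - x" "v = y + x" by blast
    have par: "even (u + v)" by (simp add: uv)
    have "a - 1 \<le> u \<and> u \<le> b + 1 \<and> c - 1 \<le> v \<and> v \<le> d + 1" "\<not> (a \<le> u \<and> u \<le> b \<and> c \<le> v \<and> v \<le> d)"
      using that by (auto simp: Box4_def uv)
    then have "(a \<le> u - 1 \<and> u - 1 \<le> b \<or> a \<le> u + 1 \<and> u + 1 \<le> b) \<and> (c \<le> v - 1 \<and> v - 1 \<le> d \<or> c \<le> v + 1 \<and> v + 1 \<le> d)"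
      using assms par unfolding tight_box_def by presburger
    then show ?thesis using that unfolding mem_bdry_iff Diff_iff by (auto simp: Box4_def uv)
  qed
  then have "bdry (Box4 a b c d) = Box4 (a - 1) (b + 1) (c - 1) (d + 1) - Box4 a b c d"
    using bdry_Box4_subset[of a b c d] by auto
  then show ?thesis using card_frame[of a b c d] assms by (simp add: tight_box_def)
qed

lemma is_box_tight:
  assumes "is_box A"
  obtains a b c d where "A = Box4 a b c d" "tight_box a b c d"
proof -
  obtain a' b' c' d' where A: "A = Box4 a' b' c' d'" and ne: "A \<noteq> {}"
    using assms unfolding is_box_def by blast
  have fin: "finite A" by (simp add: A)
  define U V where "U = (\<lambda>(x, y). y - x) ` A" and "V = (\<lambda>(x, y). y + x) ` A"
  have UV: "finite U" "U \<noteq> {}" "finite V" "V \<noteq> {}" using fin ne by (auto simp: U_def V_def)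
  have mem: "Min U \<le> y - x \<and> y - x \<le> Max U \<and> Min V \<le> y + x \<and> y + x \<le> Max V" if "(x, y) \<in> A" for x y
  proof -
    have "y - x \<in> U" "y + x \<in> V" using that by (force simp: U_def V_def)+
    then show ?thesis using UV by simp
  qed
  have "Min U \<in> U" "Max U \<in> U" "Min V \<in> V" "Max V \<in> V" using UV by auto
  then obtain x1 y1 x2 y2 x3 y3 x4 y4 where p: "(x1, y1) \<in> A" "(x2, y2) \<in> A" "(x3, y3) \<in> A" "(x4, y4) \<in> A"
    and e: "y1 - x1 = Min U" "y2 - x2 = Max U" "y3 + x3 = Min V" "y4 + x4 = Max V"
    unfolding U_def V_def by auto
  have eq: "A = Box4 (Min U) (Max U) (Min V) (Max V)"
  proof
    show "A \<subseteq> Box4 (Min U) (Max U) (Min V) (Max V)" using mem by (auto simp: Box4_def)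
    have "a' \<le> Min U" "Max U \<le> b'" "c' \<le> Min V" "Max V \<le> d'" using p by (auto simp: A Box4_def simp flip: e)
    then show "Box4 (Min U) (Max U) (Min V) (Max V) \<subseteq> A" unfolding A Box4_def by auto
  qed
  have "tight_box (Min U) (Max U) (Min V) (Max V)"
  proof -
    have "Min U \<le> Max U" "Min V \<le> Max V" using mem[OF p(1)] by linarith+
    moreover have "even (Min U + Min V) \<and> even (Max U + Min V)" if "Min V = Max V"
    proof -
      have "y1 + x1 = Min V" "y2 + x2 = Min V" using mem[OF p(1)] mem[OF p(2)] that by linarith+
      then show ?thesis using e(1,2) by presburger
    qed
    moreover have "even (Min U + Min V) \<and> even (Min U + Max V)" if "Min U = Max U"
    proof -
      have "y3 - x3 = Min U" "y4 - x4 = Min U" using mem[OF p(3)] mem[OF p(4)] that by linarith+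
      then show ?thesis using e(3,4) by presburger
    qed
    ultimately show ?thesis unfolding tight_box_def by linarith
  qed
  with eq show thesis by (rule that)
qed

section \<open>Adding a point to a box\<close>

lemma card_bdry_insert_ge:
  assumes "finite A" "adj p q" "adj p r" "q \<noteq> r" "q \<notin> A \<union> bdry A" "r \<notin> A \<union> bdry A"
  shows "card (bdry A) < card (bdry (insert p A))"
proof -
  have "q \<noteq> p" "r \<noteq> p" using assms(2,3) by (auto simp: adj_def)
  then have "insert q (insert r (bdry A - {p})) \<subseteq> bdry (insert p A)"
    using assms by (auto simp: bdry_def adj_sym)
  then have "card (insert q (insert r (bdry A - {p}))) \<le> card (bdry (insert p A))"
    using finite_bdry[of "insert p A"] assms(1) by (intro card_mono) auto
  moreover have "card (insert q (insert r (bdry A - {p}))) = card (bdry A - {p}) + 2"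
    using assms finite_bdry[OF assms(1)] by simp
  moreover have "card (bdry A) \<le> card (bdry A - {p}) + 1"
    using card.remove[OF finite_bdry[OF assms(1)], of p] by (cases "p \<in> bdry A") simp_all
  ultimately show ?thesis by linarith
qed

text \<open>A point beyond a side has two neighbours still further out. They lie outside the
  enlarged rectangle that contains the box and its boundary, so two boundary points are gained and
  at most one is lost.\<close>

lemma box_insert_bdry:
  assumes "is_box A" "p \<notin> A"
  shows "card (bdry A) < card (bdry (insert p A))"
proof -
  obtain a b c d where A: "A = Box4 a b c d" using assms(1) by (auto simp: is_box_def)
  obtain x y where p: "p = (x, y)" by force
  have out: "q \<notin> A \<union> bdry A" if "q \<notin> Box4 (a - 1) (b + 1) (c - 1) (d + 1)" for q
    using that bdry_Box4_subset[of a b c d] by (auto simp: A Box4_def)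
  have "finite A" by (simp add: A)
  note ins = card_bdry_insert_ge[OF this _ _ _ out out, of "(x, y)"]
  have "y - x < a \<or> b < y - x \<or> y + x < c \<or> d < y + x" using assms(2) by (auto simp: A p Box4_def)
  then show ?thesis unfolding p
  proof (elim disjE)
    assume "y - x < a"
    then show "card (bdry A) < card (bdry (insert (x, y) A))"
      by (intro ins[of "(x + 1, y)" "(x, y - 1)"]) (auto simp: adj_iff Box4_def)
  next
    assume "b < y - x"
    then show "card (bdry A) < card (bdry (insert (x, y) A))"
      by (intro ins[of "(x - 1, y)" "(x, y + 1)"]) (auto simp: adj_iff Box4_def)
  next
    assume "y + x < c"
    then show "card (bdry A) < card (bdry (insert (x, y) A))"
      by (intro ins[of "(x - 1, y)" "(x, y - 1)"]) (auto simp: adj_iff Box4_def)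
  next
    assume "d < y + x"
    then show "card (bdry A) < card (bdry (insert (x, y) A))"
      by (intro ins[of "(x + 1, y)" "(x, y + 1)"]) (auto simp: adj_iff Box4_def)
  qed
qed

text \<open>Choose p next to the box with a second neighbour in the box or its boundary: at most two
  neighbours are new, and p itself leaves the boundary. A single point admits no such p.\<close>

lemma box_extension_cost_one:
  assumes "is_box A" "z \<in> A" "w \<in> A" "z \<noteq> w"
  obtains p where "p \<notin> A" "card (bdry (insert p A)) \<le> card (bdry A) + 1"
proof -
  obtain a b c d where A: "A = Box4 a b c d" using assms(1) by (auto simp: is_box_def)
  have fin: "finite A" by (simp add: A)
  note found = that
  have ext: thesis
    if pq: "(x, y) \<notin> A" "q \<in> A" "adj (x, y) q" "adj (x, y) r" "q \<noteq> r" "r \<in> A \<union> bdry A" for x y q r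
  proof -
    let ?N = "{(x + 1, y), (x - 1, y), (x, y + 1), (x, y - 1)}"
    have "(x, y) \<in> bdry A" using pq by (auto simp: bdry_def)
    moreover have "s \<in> A \<union> bdry A \<union> (?N - {q, r})" if "adj (x, y) s" for s
      using that pq by (auto simp: adj_iff)
    moreover have "card (?N - {q, r}) = 2"
    proof -
      have "{q, r} \<subseteq> ?N" using pq by (auto simp: adj_iff)
      then show ?thesis using pq(5) by (subst card_Diff_subset) auto
    qed
    ultimately have "card (bdry (insert (x, y) A)) + 1 \<le> card (bdry A) + 2"
      using card_bdry_insert_le[OF fin, of "(x, y)" "?N - {q, r}"] by force
    with pq(1) show thesis by (intro found) auto
  qed
  define U where "U = (\<lambda>(x, y). y - x) ` A"
  have "finite U" "U \<noteq> {}" using fin assms(2) by (auto simp: U_def)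
  then have "Max U \<in> U" by simp
  then obtain x y where xy: "(x, y) \<in> A" "y - x = Max U" unfolding U_def by auto
  have top: "y' - x' \<le> y - x" if "(x', y') \<in> A" for x' y'
    unfolding xy(2) using \<open>finite U\<close> that by (intro Max_ge) (force simp: U_def)+
  have conv: "(x', y') \<in> A" if "a \<le> y' - x'" "y' - x' \<le> y - x" "c \<le> y' + x'" "y' + x' \<le> d" for x' y'
    using that xy(1) by (auto simp: A Box4_def)
  have bds: "a \<le> y' - x' \<and> y' - x' \<le> b \<and> c \<le> y' + x' \<and> y' + x' \<le> d" if "(x', y') \<in> A" for x' y'
    using that by (simp add: A Box4_def)
  have nA: "(x, y + 1) \<notin> A" "(x - 1, y) \<notin> A" using top[of x "y + 1"] top[of "x - 1" y] by auto
  have up: thesis if "(x + 1, y) \<in> A"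
  proof (rule ext[of x "y + 1" "(x, y)" "(x + 1, y + 1)"])
    show "(x + 1, y + 1) \<in> A \<union> bdry A" using that by (auto simp: mem_bdry_iff)
  qed (use nA xy in \<open>auto simp: adj_iff\<close>)
  have down: thesis if "(x, y - 1) \<in> A"
  proof (rule ext[of "x - 1" y "(x, y)" "(x - 1, y - 1)"])
    show "(x - 1, y - 1) \<in> A \<union> bdry A" using that by (auto simp: mem_bdry_iff)
  qed (use nA xy in \<open>auto simp: adj_iff\<close>)
  obtain x' y' where w: "(x', y') \<in> A" "(x', y') \<noteq> (x, y)" using assms by (metis surj_pair)
  have le: "y' - x' \<le> y - x" using top[OF w(1)] .
  \<comment> \<open>The second point tells where the box continues from the top point (x, y): along
    the top line, below to either side, or straight below, where parity makes the step 2.\<close>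
  consider "y' - x' = y - x" "y' + x' > y + x" | "y' - x' = y - x" "y' + x' < y + x"
    | "y' - x' < y - x" "y' + x' > y + x" | "y' - x' < y - x" "y' + x' < y + x"
    | "y' - x' < y - x" "y' + x' = y + x"
    using le w(2) by fastforce
  then show thesis
  proof cases
    case 1
    have "y + x + 2 \<le> y' + x'" using 1 by presburger
    then have "(x + 1, y + 1) \<in> A" using 1 bds[OF w(1)] bds[OF xy(1)] by (intro conv) auto
    then show thesis using nA xy by (intro ext[of x "y + 1" "(x, y)" "(x + 1, y + 1)"]) (auto simp: adj_iff)
  next
    case 2
    have "y' + x' + 2 \<le> y + x" using 2 by presburger
    then have "(x - 1, y - 1) \<in> A" using 2 bds[OF w(1)] bds[OF xy(1)] by (intro conv) auto
    then show thesis using nA xy by (intro ext[of "x - 1" y "(x, y)" "(x - 1, y - 1)"]) (auto simp: adj_iff)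
  next
    case 3
    show thesis using 3 bds[OF w(1)] bds[OF xy(1)] by (intro up conv) auto
  next
    case 4
    show thesis using 4 bds[OF w(1)] bds[OF xy(1)] by (intro down conv) auto
  next
    case 5
    have "y' - x' + 2 \<le> y - x" using 5 by presburger
    then have "(x + 1, y - 1) \<in> A" using 5 bds[OF w(1)] bds[OF xy(1)] by (intro conv) auto
    then show thesis
      using xy up by (cases "(x + 1, y) \<in> A")
        (auto intro!: ext[of "x + 1" y "(x, y)" "(x + 1, y - 1)"] simp: adj_iff)
  qed
qed

subsection \<open>Dead sets\<close>

lemma dead_iff:
  assumes "minimal A"
  shows "dead A \<longleftrightarrow> \<not> (\<exists>p. p \<notin> A \<and> minimal (insert p A))"
proof -
  let ?chain = "\<lambda>n S. S 0 = A \<and> (\<forall>i\<le>n. minimal (S i) \<and> card (S i) = card A + i) \<and> (\<forall>i<n. S i \<subseteq> S (Suc i))"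
  have fin: "finite A" using assms by (rule minimal_finite)
  have "life_expectancy A = 0 \<longleftrightarrow> (\<forall>n. (\<exists>S. ?chain n S) \<longrightarrow> n = 0)"
  proof -
    have "life_expectancy A \<le> 0 \<longleftrightarrow> (\<forall>n. (\<exists>S. ?chain n S) \<longrightarrow> enat n \<le> 0)"
      unfolding life_expectancy_def Sup_le_iff by blast
    then show ?thesis by (simp add: enat_0_iff)
  qed
  moreover have "\<exists>p. p \<notin> A \<and> minimal (insert p A)" if "?chain n S" "n \<noteq> 0" for n S
  proof -
    have "S 0 \<subseteq> S (Suc 0)" "minimal (S (Suc 0))" "card (S (Suc 0)) = card A + 1" "S 0 = A"
      using that by (auto simp: Suc_le_eq)
    then have S: "A \<subseteq> S 1" "minimal (S 1)" "card (S 1) = card A + 1" by auto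
    then have "card (S 1 - A) = 1" using fin by (simp add: card_Diff_subset)
    then obtain p where "S 1 - A = {p}" by (auto simp: card_1_singleton_iff)
    then have "p \<notin> A" "S 1 = insert p A" using S(1) by auto
    with S(2) show ?thesis by metis
  qed
  moreover have "\<exists>S. ?chain 1 S" if "p \<notin> A" "minimal (insert p A)" for p
  proof (rule exI[of _ "\<lambda>i. if i = 0 then A else insert p A"])
    show "?chain 1 (\<lambda>i. if i = 0 then A else insert p A)"
      using that assms fin by (auto simp: le_Suc_eq)
  qed
  ultimately show ?thesis using assms unfolding dead_def by (metis One_nat_def zero_neq_one)
qed

lemma dead_imp_box:
  assumes "dead A"
  shows "is_box A"
proof (rule saturated_minimal_is_box)
  have min: "minimal A" using assms by (simp add: dead_def)
  show "saturated_minimal A"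
  proof
    fix p assume p: "p \<notin> A"
    show "card (bdry A) < card (bdry (insert p A))"
    proof (rule ccontr)
      assume "\<not> ?thesis"
      moreover have "card (bdry A) \<le> card (bdry C)" if "finite C" "card C = card (insert p A)" for C
        using minimal_bdry_le[OF min that(1)] that(2) minimal_finite[OF min] p by simp
      ultimately have "minimal (insert p A)"
        using minimal_finite[OF min] unfolding minimal_def by fastforce
      with p assms dead_iff[OF min] show False by blast
    qed
  qed (rule min)
qed

text \<open>A larger set with the same boundary size caps the boundary of any minimal one-point
  extension, whereas a box can only be extended at a cost.\<close>

lemma inefficient_box_dead:
  assumes min: "minimal A" and box: "is_box A" and "\<not> efficient A"
  shows "dead A"
proof -
  have fin: "finite A" using min by (rule minimal_finite)
  then obtain C where C: "finite C" "card (bdry C) = card (bdry A)" "card A < card C"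
    using assms(3) by (auto simp: efficient_def not_le)
  have False if "p \<notin> A" "minimal (insert p A)" for p
  proof -
    have "card (bdry (insert p A)) \<le> card (bdry C)"
      using minimal_bdry_le[OF that(2) C(1)] C(3) that(1) fin by simp
    with C(2) box_insert_bdry[OF box that(1)] show False by simp
  qed
  then show ?thesis using dead_iff[OF min] by blast
qed

text \<open>By efficiency every set with one more point has a larger boundary, so an extension of
  cost one is minimal. A single point needs separate care: its extension raises the boundary from 4
  to 6.\<close>

lemma efficient_box_not_dead:
  assumes min: "minimal A" and box: "is_box A" and eff: "efficient A"
  shows "\<not> dead A"
proof -
  have fin: "finite A" and ne: "A \<noteq> {}" using min by (auto simp: minimal_def)
  obtain p where p: "p \<notin> A"
    and le: "\<And>C. finite C \<Longrightarrow> card C = card A + 1 \<Longrightarrow> card (bdry (insert p A)) \<le> card (bdry C)"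
  proof (cases "\<exists>z\<in>A. \<exists>w\<in>A. z \<noteq> w")
    case True
    then obtain p where p: "p \<notin> A" "card (bdry (insert p A)) \<le> card (bdry A) + 1"
      using box_extension_cost_one[OF box] by metis
    have "card (bdry A) + 1 \<le> card (bdry C)" if C: "finite C" "card C = card A + 1" for C
    proof -
      have "card (bdry A) \<le> card (bdry C)" using C by (intro minimal_bdry_le[OF min]) auto
      moreover have "card (bdry C) \<noteq> card (bdry A)" using eff C by (auto simp: efficient_def)
      ultimately show ?thesis by simp
    qed
    with p show thesis by (meson order_trans that)
  next
    case False
    then obtain z where z: "A = {z}" using ne by blast
    obtain x y where xy: "z = (x, y)" by force
    let ?p = "(x + 1, y)" and ?Q = "{(x + 2, y), (x + 1, y + 1), (x + 1, y - 1)}"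
    have "bdry A \<subseteq> {(x + 1, y), (x - 1, y), (x, y + 1), (x, y - 1)}"
      by (auto simp: bdry_def z xy adj_iff adj_sym[of _ "(x, y)"])
    then have "card (bdry A) \<le> card {(x + 1, y), (x - 1, y), (x, y + 1), (x, y - 1)}"
      by (intro card_mono) auto
    also have "\<dots> = 4" by simp
    finally have four: "card (bdry A) \<le> 4" .
    have "?p \<in> bdry A" by (simp add: mem_bdry_iff z xy)
    moreover have "s \<in> A \<union> bdry A \<union> ?Q" if "adj ?p s" for s
      using that by (auto simp: adj_iff z xy)
    ultimately have "card (bdry (insert ?p A)) + 1 \<le> card (bdry A) + card ?Q"
      by (intro card_bdry_insert_le[OF fin]) auto
    with four have six: "card (bdry (insert ?p A)) \<le> 6" by simp
    have "6 \<le> card (bdry C)" if "finite C" "card C = card A + 1" for C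
    proof (rule ccontr)
      assume "\<not> ?thesis"
      \<comment> \<open>Two points with at most five boundary points would give 16 \<le> 3^2 +
        4.\<close>
      then have "\<bar>int (card (bdry C)) - 2\<bar> \<le> 3" by linarith
      then have "(int (card (bdry C)) - 2)\<^sup>2 \<le> 3\<^sup>2" 
        using abs_le_square_iff[of "int (card (bdry C)) - 2" 3] by simp
      moreover have "8 * int (card C) \<le> (int (card (bdry C)) - 2)\<^sup>2 + 4"
        using that by (intro isoperimetric) auto
      ultimately show False using that(2) z by simp
    qed
    with six show thesis by (intro that[of ?p]) (auto simp: z xy intro: order_trans)
  qed
  have "minimal (insert p A)"
    unfolding minimal_def using fin p le by simp
  with p show ?thesis using dead_iff[OF min] by blast
qed

subsection \<open>Efficient boxes\<close>

text \<open>Trim a larger set to \<open>card A + 1\<close> points. Minimality of A bounds the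
  trimmed boundary from below, so it has exactly the size that efficiency speaks about.\<close>

lemma efficient_card_le:
  assumes min: "minimal A" and eff: "efficient A" and C: "finite C" "card (bdry C) \<le> card (bdry A)"
  shows "card C \<le> card A"
proof (rule ccontr)
  assume "\<not> ?thesis"
  then obtain D where D: "D \<subseteq> C" "card D = card A + 1" "card (bdry D) \<le> card (bdry C)"
    using exists_subset_bdry_le[OF C(1), of "card A + 1"] by auto
  have fin: "finite D" using D(1) C(1) by (rule finite_subset)
  have "card (bdry A) \<le> card (bdry D)" using D(2) by (intro minimal_bdry_le[OF min fin]) simp
  with D(3) C(2) have "card (bdry D) = card (bdry A)" by simp
  then have "card D \<le> card A" using eff fin by (simp add: efficient_def)
  with D(2) show False by simp
qed

text \<open>The 3 in \<open>near\<close> and the 4 of the isoperimetric inequality add up to 7, and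
  sizes enter multiplied by 8, so integrality closes the argument.\<close>

lemma efficient_Box2:
  assumes ab: "0 \<le> \<alpha>" "0 \<le> \<beta>"
    and near: "(\<alpha> + \<beta> + 2)\<^sup>2 \<le> 4 * ((\<alpha> + 1) * (\<beta> + 1) + box_excess 0 \<alpha> 0 \<beta>) + 3"
  shows "efficient (Box2 \<alpha> \<beta>)"
proof -
  have card: "2 * int (card (Box2 \<alpha> \<beta>)) = (\<alpha> + 1) * (\<beta> + 1) + box_excess 0 \<alpha> 0 \<beta>"
    using card_Box4[of 0 \<alpha> 0 \<beta>] ab by (simp add: Box2_def)
  have bd: "int (card (bdry (Box2 \<alpha> \<beta>))) \<le> \<alpha> + \<beta> + 4"
    using card_bdry_Box4_le[of 0 \<alpha> 0 \<beta>] ab by (simp add: Box2_def)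
  have "card C \<le> card (Box2 \<alpha> \<beta>)" if C: "finite C" "card (bdry C) = card (bdry (Box2 \<alpha> \<beta>))" for C
  proof (cases "C = {}")
    case False
    have "8 * int (card C) \<le> (int (card (bdry C)) - 2)\<^sup>2 + 4" by (rule isoperimetric[OF C(1) False])
    moreover have "(int (card (bdry C)) - 2)\<^sup>2 \<le> (\<alpha> + \<beta> + 2)\<^sup>2"
    proof -
      have "\<bar>int (card (bdry C)) - 2\<bar> \<le> \<bar>\<alpha> + \<beta> + 2\<bar>" using bd C(2) ab by linarith
      then show ?thesis by (simp add: abs_le_square_iff)
    qed
    moreover have "(\<alpha> + \<beta> + 2)\<^sup>2 \<le> 8 * int (card (Box2 \<alpha> \<beta>)) + 3"
      using near unfolding card[symmetric] by simp
    ultimately have "8 * int (card C) \<le> 8 * int (card (Box2 \<alpha> \<beta>)) + 7" by linarith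
    then show ?thesis by linarith
  qed simp
  then show ?thesis by (simp add: efficient_def Box2_def)
qed

lemma efficient_Box2_listed:
  "efficient (Box2 (int m) (int m))" "efficient (Box2 (int m) (int m + 1))"
  "odd m \<Longrightarrow> efficient (Box2 (int m - 1) (int m + 1))"
proof -
  show "efficient (Box2 (int m) (int m))" "efficient (Box2 (int m) (int m + 1))"
    by (rule efficient_Box2; simp add: box_excess_def power2_eq_square algebra_simps)+
  assume "odd m"
  then have "1 \<le> m" by (cases m) auto
  then show "efficient (Box2 (int m - 1) (int m + 1))"
    using \<open>odd m\<close> by (intro efficient_Box2) (auto simp: box_excess_def power2_eq_square algebra_simps)
qed

section \<open>Congruences of boxes\<close>

lemma congruent_efficient:
  assumes "congruent_sets A C" "efficient C"
  shows "efficient A"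
proof -
  obtain f where f: "automorphism f" "f ` A = C" using assms(1) by (auto simp: congruent_sets_def)
  have "card (bdry C) = card (bdry A)" "card C = card A"
    using automorphism_card[OF f(1)] automorphism_bdry_image[OF f(1), of A] f(2) by auto
  moreover have "finite A"
    using assms(2) f unfolding efficient_def automorphism_def
    by (metis bij_is_inj finite_imageD inj_on_subset top_greatest)
  ultimately show ?thesis using assms(2) by (simp add: efficient_def)
qed

lemma congruent_trans:
  assumes "congruent_sets A B" "congruent_sets B C"
  shows "congruent_sets A C"
proof -
  obtain f g where "automorphism f" "f ` A = B" "automorphism g" "g ` B = C"
    using assms by (auto simp: congruent_sets_def)
  then have "automorphism (g \<circ> f)" "(g \<circ> f) ` A = C"
    unfolding automorphism_def by (simp_all add: bij_comp image_comp del: split_paired_All) blast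
  then show ?thesis by (auto simp: congruent_sets_def)
qed

lemma congruent_by_inverse:
  assumes "\<And>p. g (f p) = p" "\<And>p. f (g p) = p" "\<And>u v. adj (f u) (f v) \<longleftrightarrow> adj u v"
    and "\<And>p. g p \<in> A \<longleftrightarrow> p \<in> C"
  shows "congruent_sets A C"
proof -
  have "bij f" using assms(1,2) by (intro o_bij[of g]) auto
  then have "automorphism f" using assms(3) by (simp add: automorphism_def)
  moreover have "f ` A = C"
  proof (intro equalityI subsetI)
    fix q assume "q \<in> C"
    then have "g q \<in> A" "q = f (g q)" using assms by auto
    then show "q \<in> f ` A" by blast
  next
    fix q assume "q \<in> f ` A"
    then obtain p where "p \<in> A" "q = f p" by blast
    then show "q \<in> C" using assms(1)[of p] assms(4)[of q] by simp
  qed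
  ultimately show ?thesis by (auto simp: congruent_sets_def)
qed

text \<open>A translation moves u and v by amounts of equal parity, so the corner can be brought to
  the origin only if \<open>a + c\<close> is even.\<close>

lemma congruent_translate:
  assumes "even (a + c)"
  shows "congruent_sets (Box4 a b c d) (Box2 (b - a) (d - c))"
proof -
  obtain i j where ij: "a = j - i" "c = j + i" using diag_coordinates[OF assms] by blast
  show ?thesis
    by (rule congruent_by_inverse[of "\<lambda>(x, y). (x + i, y + j)" "\<lambda>(x, y). (x - i, y - j)"])
      (auto simp: adj_def Box2_def Box4_def ij)
qed

lemma congruent_flip_u: "congruent_sets (Box4 a b c d) (Box4 (- b) (- a) c d)"
  by (rule congruent_by_inverse[of prod.swap prod.swap]) (auto simp: adj_def Box4_def add.commute)

lemma congruent_flip_v: "congruent_sets (Box4 a b c d) (Box4 a b (- d) (- c))"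
  by (rule congruent_by_inverse[of "\<lambda>(x, y). (- y, - x)" "\<lambda>(x, y). (- y, - x)"]) (auto simp: adj_def Box4_def)

lemma congruent_exchange: "congruent_sets (Box4 a b c d) (Box4 c d a b)"
  by (rule congruent_by_inverse[of "\<lambda>(x, y). (- x, y)" "\<lambda>(x, y). (- x, y)"]) (auto simp: adj_def Box4_def)

text \<open>If the corner has the wrong parity, reflecting across an odd width repairs it. Only two
  even widths with a + c odd resist, and this is excess -1.\<close>

lemma congruent_Box2:
  assumes "box_excess a b c d \<noteq> - 1"
  shows "congruent_sets (Box4 a b c d) (Box2 (b - a) (d - c))"
    "congruent_sets (Box4 a b c d) (Box2 (d - c) (b - a))"
proof -
  have "even (a + c) \<or> even (- b + c) \<or> even (a + - d)"
    using assms unfolding box_excess_def by presburger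
  then show 1: "congruent_sets (Box4 a b c d) (Box2 (b - a) (d - c))"
  proof (elim disjE)
    assume "even (- b + c)"
    then show ?thesis
      using congruent_trans[OF congruent_flip_u[of a b c d] congruent_translate[of "- b" c "- a" d]] by simp
  next
    assume "even (a + - d)"
    then show ?thesis
      using congruent_trans[OF congruent_flip_v[of a b c d] congruent_translate[of a "- d" b "- c"]] by simp
  qed (rule congruent_translate)
  show "congruent_sets (Box4 a b c d) (Box2 (d - c) (b - a))"
    using congruent_trans[OF 1] congruent_exchange[of 0 "b - a" 0 "d - c"] by (simp add: Box2_def)
qed

text \<open>Compare A with the most balanced box of the same total width. That box has no larger
  boundary, hence no more points. Moving the widths off balance by t loses t * t, or t * t - t for
  an odd total, from the product of the side counts, and only the parity excess can repay
  it.\<close>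

lemma efficient_box_listed:
  assumes min: "minimal A" and box: "is_box A" and eff: "efficient A"
  shows "\<exists>m::nat. congruent_sets A (Box2 (int m) (int m)) \<or> congruent_sets A (Box2 (int m) (int m + 1)) \<or>
    odd m \<and> congruent_sets A (Box2 (int m - 1) (int m + 1))"
proof -
  obtain a b c d where A: "A = Box4 a b c d" and tight: "tight_box a b c d" using is_box_tight[OF box] .
  define \<alpha> \<beta> where "\<alpha> = b - a" and "\<beta> = d - c"
  define \<epsilon> where "\<epsilon> = box_excess a b c d"
  have nn: "0 \<le> \<alpha>" "0 \<le> \<beta>" using tight by (auto simp: tight_box_def \<alpha>_def \<beta>_def)
  define m where "m = (\<alpha> + \<beta>) div 2"
  define k where "k = \<alpha> + \<beta> - m"
  have m: "0 \<le> m" "0 \<le> k" "k = m \<or> k = m + 1" using nn by (auto simp: m_def k_def)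
  have cong: "congruent_sets A (Box2 \<alpha> \<beta>)" "congruent_sets A (Box2 \<beta> \<alpha>)" if "\<epsilon> \<noteq> - 1"
    using congruent_Box2[of a b c d] that unfolding A \<alpha>_def \<beta>_def \<epsilon>_def by auto
  have "int (card (bdry (Box2 m k))) \<le> int (card (bdry A))"
    using card_bdry_tight_box[OF tight] card_bdry_Box4_le[of 0 m 0 k] m
    by (simp add: Box2_def A \<alpha>_def \<beta>_def k_def)
  then have "card (Box2 m k) \<le> card A" by (intro efficient_card_le[OF min eff]) (auto simp: Box2_def)
  then have main: "(m + 1) * (k + 1) + box_excess 0 m 0 k \<le> (\<alpha> + 1) * (\<beta> + 1) + \<epsilon>"
    using card_Box4[of a b c d] card_Box4[of 0 m 0 k] m tight
    by (simp add: Box2_def A tight_box_def \<alpha>_def \<beta>_def \<epsilon>_def)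
  have eps: "\<epsilon> = (if even \<alpha> \<and> even \<beta> then if even (a + c) then 1 else - 1 else 0)"
    by (simp add: \<epsilon>_def box_excess_def \<alpha>_def \<beta>_def)
  define t where "t = \<alpha> - m"
  have ab: "\<alpha> = m + t" "\<beta> = k - t" by (auto simp: t_def k_def)
  have goal: ?thesis
    if "congruent_sets A (Box2 m m) \<or> congruent_sets A (Box2 m (m + 1)) \<or>
      odd m \<and> congruent_sets A (Box2 (m - 1) (m + 1))"
    using that m by (intro exI[of _ "nat m"]) (auto simp: even_nat_iff)
  from m(3) show ?thesis
  proof
    assume k: "k = m"
    have "t * t \<le> \<epsilon> - box_excess 0 m 0 m"
      using main unfolding ab k by (simp add: algebra_simps)
    moreover have "box_excess 0 m 0 m = (if even m then 1 else 0)" by (simp add: box_excess_def)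
    moreover have "\<epsilon> \<le> 1" by (simp add: eps)
    moreover have "t = 0 \<or> 1 \<le> t * t" using zero_le_square[of t] by (cases "t = 0") (auto simp: int_one_le_iff_zero_less less_le)
    \<comment> \<open>For even m the balanced box already has excess 1, which forces t = 0. For odd
      m an excess 1 of A can pay for t of absolute value 1; this is the third family.\<close>
    ultimately consider "t = 0" "0 \<le> \<epsilon>" | "t * t \<le> 1" "odd m" "\<epsilon> = 1"
      using zero_le_square[of t] by (auto split: if_splits)
    then show ?thesis
    proof cases
      case 1
      then show ?thesis using cong(1) k by (intro goal) (simp add: ab)
    next
      case 2
      have "\<bar>t\<bar> \<le> 1" using 2(1) abs_le_square_iff[of t 1] by (simp add: power2_eq_square)
      then consider "t = 0" | "t = 1" | "t = - 1" by linarith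
      then show ?thesis using cong 2 k by cases (auto intro!: goal simp: ab)
    qed
  next
    assume k: "k = m + 1"
    have "\<alpha> + \<beta> = 2 * m + 1" using k by (simp add: k_def)
    then have "odd (\<alpha> + \<beta>)" by (simp only:) simp
    then have e0: "\<epsilon> = 0" by (auto simp: eps)
    have "t * t \<le> t" using main unfolding ab k e0 by (simp add: box_excess_def algebra_simps)
    then have "t = 0 \<or> t = 1"
    proof -
      assume "t * t \<le> t"
      then have "t * (t - 1) \<le> 0" by (simp add: algebra_simps)
      then have "0 \<le> t" "t \<le> 1" by (auto simp: mult_le_0_iff)
      then show ?thesis by linarith
    qed
    then have "\<alpha> = m \<and> \<beta> = m + 1 \<or> \<beta> = m \<and> \<alpha> = m + 1" using ab k by auto
    then have "congruent_sets A (Box2 m (m + 1))" using cong e0 by auto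
    then show ?thesis by (intro goal) simp
  qed
qed

theorem theorem8p5:
  fixes A :: "(int \<times> int) set"
  assumes "minimal A"
  shows "(dead A \<longleftrightarrow> is_box A \<and> \<not> efficient A) \<and>
    (is_box A \<and> \<not> efficient A \<longleftrightarrow>
      is_box A \<and>
      (\<forall>m::nat. \<not> congruent_sets A (Box2 (int m) (int m)) \<and>
                \<not> congruent_sets A (Box2 (int m) (int m + 1))) \<and>
      (\<forall>m::nat. odd m \<longrightarrow> \<not> congruent_sets A (Box2 (int m - 1) (int m + 1))))"
proof (intro conjI)
  show "dead A \<longleftrightarrow> is_box A \<and> \<not> efficient A"
    using dead_imp_box inefficient_box_dead[OF assms] efficient_box_not_dead[OF assms] by blast
  show "is_box A \<and> \<not> efficient A \<longleftrightarrow>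
      is_box A \<and>
      (\<forall>m::nat. \<not> congruent_sets A (Box2 (int m) (int m)) \<and>
                \<not> congruent_sets A (Box2 (int m) (int m + 1))) \<and>
      (\<forall>m::nat. odd m \<longrightarrow> \<not> congruent_sets A (Box2 (int m - 1) (int m + 1)))"
    using congruent_efficient efficient_Box2_listed efficient_box_listed[OF assms] by metis
qed

end
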